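(* The set of Hurwitz normal numbers $\mathrm{Nrm}(\mu_{\mathrm{H}})\subseteq\mathbb{C}$ is not a countable intersection of open subsets of $\mathbb{C}$, and it is not a countable union of closed subsets of $\mathbb{C}$, nor even a countable union of $G_\delta$ subsets of $\mathbb{C}$.
   Context: For $z\in\mathbb{C}$, $[z]:=\lfloor \mathrm{Re}(z)+\tfrac12\rfloor+i\lfloor \mathrm{Im}(z)+\tfrac12\rfloor$. Let $\mathfrak{F}:=\{z: -\tfrac12\le \mathrm{Re}(z)<\tfrac12,\ -\tfrac12\le \mathrm{Im}(z)<\tfrac12\}$ and let $T:\mathfrak{F}\to\mathfrak{F}$ be $T(0)=0$, $T(z)=z^{-1}-[z^{-1}]$ for $z\ne0$. Hurwitz partial quotients: $a_1(z)=[z^{-1}]$ and $a_n(z)=a_1(T^{n-1}(z))$ whenever $T^{n-1}(z)\neq 0$; for $z\in\mathfrak{F}\setminus\mathbb{Q}(i)$ all $a_n(z)$ are defined. Cylinders: $\mathcal{C}_n(b_1,\dots,b_n):=\{z\in\mathfrak{F}:a_j(z)=b_j,\ 1\le j\le n\}$; a word $(b_1,\dots,b_n)$ of Gaussian integers is regular if $\mathcal{C}_n(b_1,\dots,b_n)$ has nonempty interior. Let $\mu_{\mathrm{H}}$ be the unique $T$-ergodic Borel probability measure on $\mathfrak{F}$ equivalent to Lebesgue measure. A number $z\in\mathfrak{F}\setminus\mathbb{Q}(i)$ is a Hurwitz normal number if for every $n\in\mathbb{N}$ and every regular word $\mathbf{b}$ of length $n$, \[ \lim_{N\to\infty}\frac{\#\{j\in\{0,\dots,N-1\}:(a_{j+1}(z),\dots,a_{j+n}(z))=\mathbf{b}\}}{N}=\mu_{\mathrm{H}}(\mathcal{C}_n(\mathbf{b})).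 \] $\mathrm{Nrm}(\mu_{\mathrm{H}})$ denotes the set of Hurwitz normal numbers. *)

theory Defs
  imports "HOL-Probability.Probability"
begin

definition gauss_int :: "complex set" where
  "gauss_int = {z. Re z \<in> \<int> \<and> Im z \<in> \<int>}"

definition gauss_rat :: "complex set" where
  "gauss_rat = {z. Re z \<in> \<rat> \<and> Im z \<in> \<rat>}"

definition nearest_gauss :: "complex \<Rightarrow> complex" where
  "nearest_gauss z = Complex (of_int \<lfloor>Re z + 1/2\<rfloor>) (of_int \<lfloor>Im z + 1/2\<rfloor>)"

definition hurwitz_domain :: "complex set" where
  "hurwitz_domain = {z. - 1/2 \<le> Re z \<and> Re z < 1/2 \<and> - 1/2 \<le> Im z \<and> Im z < 1/2}"

definition hurwitz_map :: "complex \<Rightarrow> complex" where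
  "hurwitz_map z = (if z = 0 then 0 else inverse z - nearest_gauss (inverse z))"

lemma hurwitz_map_in_domain: "hurwitz_map z \<in> hurwitz_domain"
proof -
  have "w - nearest_gauss w \<in> hurwitz_domain" for w
    unfolding hurwitz_domain_def nearest_gauss_def mem_Collect_eq minus_complex.sel complex.sel
    by linarith
  moreover have "0 \<in> hurwitz_domain"
    by (simp add: hurwitz_domain_def)
  ultimately show ?thesis
    by (simp add: hurwitz_map_def)
qed

text \<open>Partial quotients are indexed from 1, and \<open>hurwitz_quotient n z\<close> is meaningful only if
  \<open>(hurwitz_map ^^ (n - 1)) z \<noteq> 0\<close>; cylinders therefore require this explicitly.\<close>

definition hurwitz_quotient :: "nat \<Rightarrow> complex \<Rightarrow> complex" where
  "hurwitz_quotient n z = nearest_gauss (inverse ((hurwitz_map ^^ (n - 1)) z))"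

definition hurwitz_cylinder :: "complex list \<Rightarrow> complex set" where
  "hurwitz_cylinder b = {z \<in> hurwitz_domain. \<forall>j\<in>{1..length b}.
     (hurwitz_map ^^ (j - 1)) z \<noteq> 0 \<and> hurwitz_quotient j z = b ! (j - 1)}"

definition regular_word :: "complex list \<Rightarrow> bool" where
  "regular_word b \<longleftrightarrow> set b \<subseteq> gauss_int \<and> interior (hurwitz_cylinder b) \<noteq> {}"

definition ergodic_measure :: "'a measure \<Rightarrow> ('a \<Rightarrow> 'a) \<Rightarrow> bool" where
  "ergodic_measure M f \<longleftrightarrow>
     prob_space M \<and> f \<in> measurable M M \<and> distr M M f = M \<and>
     (\<forall>A\<in>sets M. f -` A \<inter> space M = A \<longrightarrow> measure M A = 0 \<or> measure M A = 1)"

text \<open>The defining property of the measure \<open>\<mu>\<^sub>H\<close>. Any two measures with this property coincide,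
  since distinct ergodic measures of the same map are mutually singular.\<close>

definition is_hurwitz_measure :: "complex measure \<Rightarrow> bool" where
  "is_hurwitz_measure \<mu> \<longleftrightarrow>
     sets \<mu> = sets (restrict_space borel hurwitz_domain) \<and>
     ergodic_measure \<mu> hurwitz_map \<and>
     absolutely_continuous (restrict_space lborel hurwitz_domain) \<mu> \<and>
     absolutely_continuous \<mu> (restrict_space lborel hurwitz_domain)"

definition hurwitz_normal :: "complex measure \<Rightarrow> complex set" where
  "hurwitz_normal \<mu> = {z \<in> hurwitz_domain - gauss_rat.
     \<forall>n\<ge>1. \<forall>b. length b = n \<and> regular_word b \<longrightarrow>
       (\<lambda>N. real (card {j \<in> {0..<N}. map (\<lambda>k. hurwitz_quotient (j + k) z) [1..<n + 1] = b}) / real N)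
         \<longlonglongrightarrow> measure \<mu> (hurwitz_cylinder b)}"

end

theory Submission
  imports Defs
begin

text \<open>
  Almost every point is normal by the pointwise ergodic theorem, and its orbit avoids the sides of the
  square and all unit circles around Gaussian integers. Call two points of the open square equivalent if
  they lie on the same side of each of these circles. Since inversion maps this family of circles
  and the sides of the square to one another, \<open>u \<mapsto> 1 / (b + u)\<close> respects the equivalence; and all points
  \<open>1 / (3 + u)\<close> are equivalent. Hence whatever follows a digit 3 of a typical expansion may be replaced by
  any other expansion without violating admissibility.

  Fix a typical point and a rapidly growing sequence \<open>p k\<close> of positions of the digit 3. For a sequence \<open>x\<close>
  of natural numbers overwrite about \<open>p k / (x k + 1)\<close> digits after position \<open>p k\<close> by 3, for every \<open>k\<close>. The
  resulting point depends continuously on \<open>x\<close> and is normal iff \<open>x\<close> tends to infinity. The sequences tending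
  to infinity do not form a countable union of \<open>G\<^sub>\<delta>\<close> sets, by a Baire category argument.
\<close>

section \<open>The pointwise ergodic theorem for indicator functions\<close>

lemma ergodic_measureD:
  assumes "ergodic_measure M T"
  shows "prob_space M" "T \<in> measurable M M" "distr M M T = M"
    and "A \<in> sets M \<Longrightarrow> T -` A \<inter> space M = A \<Longrightarrow> measure M A = 0 \<or> measure M A = 1"
  using assms by (auto simp: ergodic_measure_def)

text \<open>The maximum of the Birkhoff sums of \<open>g\<close> of length at most \<open>n\<close>. The recursion is what
  Garsia's proof of the maximal inequality uses: where the maximum is positive, \<open>g\<close> equals
  \<open>birkhoff_max T g (Suc n) - birkhoff_max T g n \<circ> T\<close>, so its integral there is nonnegative.\<close>

primrec birkhoff_max :: "('a \<Rightarrow> 'a) \<Rightarrow> ('a \<Rightarrow> real) \<Rightarrow> nat \<Rightarrow> 'a \<Rightarrow> real" where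
  "birkhoff_max T g 0 = (\<lambda>x. 0)"
| "birkhoff_max T g (Suc n) = (\<lambda>x. max 0 (g x + birkhoff_max T g n (T x)))"

lemma birkhoff_max_nonneg: "0 \<le> birkhoff_max T g n x"
  by (cases n) auto

lemma birkhoff_max_mono_Suc: "birkhoff_max T g n x \<le> birkhoff_max T g (Suc n) x"
proof (induction n arbitrary: x)
  case (Suc n)
  show ?case using Suc[of "T x"] by auto
qed auto

lemma birkhoff_max_mono: "m \<le> n \<Longrightarrow> birkhoff_max T g m x \<le> birkhoff_max T g n x"
  by (rule lift_Suc_mono_le[of "\<lambda>n. birkhoff_max T g n x"]) (rule birkhoff_max_mono_Suc)

lemma birkhoff_sum_le_max: "(\<Sum>i<n. g ((T ^^ i) x)) \<le> birkhoff_max T g n x"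
proof (induction n arbitrary: x)
  case (Suc n)
  have "(\<Sum>i<Suc n. g ((T ^^ i) x)) = g x + (\<Sum>i<n. g ((T ^^ i) (T x)))"
    by (simp only: sum.lessThan_Suc_shift funpow_Suc_right o_apply) simp
  then show ?case using Suc[of "T x"] by auto
qed auto

lemma birkhoff_max_le:
  assumes "\<And>x. \<bar>g x\<bar> \<le> B"
  shows "birkhoff_max T g n x \<le> real n * B"
proof (induction n arbitrary: x)
  case (Suc n)
  have "0 \<le> B" using assms[of x] by linarith
  then show ?case using Suc[of "T x"] assms[of x] by (auto simp: algebra_simps)
qed auto

lemma birkhoff_max_measurable:
  assumes "T \<in> measurable M M" "g \<in> borel_measurable M"
  shows "birkhoff_max T g n \<in> borel_measurable M"
proof (induction n)
  case (Suc n)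
  have "(\<lambda>x. birkhoff_max T g n (T x)) \<in> borel_measurable M"
    using measurable_compose[OF assms(1) Suc] .
  then show ?case using assms(2) by simp
qed simp

text \<open>Passing from \<open>x\<close> to \<open>T x\<close> changes the sums by at most
  \<open>B\<close>, so the set \<open>E\<close> of points with unbounded sums is invariant and has
  measure 0 or 1. Were it 1, the maximal inequality on sets exhausting almost the whole space would
  give a nonnegative integral of \<open>g\<close>.\<close>

lemma ergodic_birkhoff_sum_bounded_above:
  fixes g :: "'a \<Rightarrow> real"
  assumes erg: "ergodic_measure M T"
    and g [measurable]: "g \<in> borel_measurable M" and B: "\<And>x. \<bar>g x\<bar> \<le> B"
    and neg: "integral\<^sup>L M g < 0"
  shows "AE x in M. \<exists>K. \<forall>n. (\<Sum>i<n. g ((T ^^ i) x)) \<le> K"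
proof -
  interpret prob_space M using ergodic_measureD(1)[OF erg] .
  note T [measurable] = ergodic_measureD(2)[OF erg]
  define S where "S = (\<lambda>n x. \<Sum>i<n. g ((T ^^ i) x))"
  have Tn [measurable]: "T ^^ i \<in> measurable M M" for i
    by (induction i) (auto simp: measurable_compose[OF _ T] comp_def)
  have S [measurable]: "S n \<in> borel_measurable M" for n
    unfolding S_def by measurable
  \<comment> \<open>The bounds range over the naturals, so that \<open>E\<close> is a countable
    combination of measurable sets.\<close>
  define E where "E = {x \<in> space M. \<forall>K::nat. \<exists>n. S n x > real K}"
  have E [measurable]: "E \<in> sets M" unfolding E_def by measurable
  have shift: "S (Suc n) x = g x + S n (T x)" for n x
    unfolding S_def by (simp only: sum.lessThan_Suc_shift funpow_Suc_right o_apply) simp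
  have "T x \<in> E \<longleftrightarrow> x \<in> E" if x: "x \<in> space M" for x
  proof -
    have Tx: "T x \<in> space M" using x T by (rule measurable_space[rotated])
    have "\<exists>n. S n x > real K" if "\<forall>K::nat. \<exists>n. S n (T x) > real K" for K
    proof -
      obtain n where "S n (T x) > real (K + nat \<lceil>B\<rceil>)" using \<open>\<forall>K::nat. \<exists>n. S n (T x) > real K\<close> by blast
      moreover have "real (nat \<lceil>B\<rceil>) \<ge> B" by linarith
      ultimately have "S (Suc n) x > real K" using B[of x] unfolding shift of_nat_add by linarith
      then show ?thesis by blast
    qed
    moreover have "\<exists>n. S n (T x) > real K" if "\<forall>K::nat. \<exists>n. S n x > real K" for K
    proof -
      obtain n where n: "S n x > real (K + nat \<lceil>B\<rceil>)" using \<open>\<forall>K::nat. \<exists>n. S n x > real K\<close> by blast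
      have "n \<noteq> 0" using n by (intro notI) (simp add: S_def)
      then obtain m where "n = Suc m" by (cases n) auto
      moreover have "real (nat \<lceil>B\<rceil>) \<ge> B" by linarith
      ultimately have "S m (T x) > real K" using B[of x] n unfolding shift of_nat_add by (simp add: shift) linarith
      then show ?thesis by blast
    qed
    ultimately show ?thesis using x Tx unfolding E_def by blast
  qed
  then have "T -` E \<inter> space M = E" using sets.sets_into_space[OF E] by blast
  then have "prob E = 0 \<or> prob E = 1" using ergodic_measureD(4)[OF erg E] by blast
  moreover have "prob E \<noteq> 1"
  proof
    assume "prob E = 1"
    then have AE_E: "AE x in M. x \<in> E" by (rule AE_prob_1)
    define m where "m = birkhoff_max T g"
    have m [measurable]: "m n \<in> borel_measurable M" for n
      unfolding m_def by (rule birkhoff_max_measurable[OF T g])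
    have m_int: "integrable M (m n)" for n
      by (rule integrable_const_bound[where B = "real n * B"])
        (use m in \<open>auto simp: m_def birkhoff_max_nonneg birkhoff_max_le[of g B, OF B] intro!: AE_I2\<close>)
    have mT: "integrable M (\<lambda>x. m n (T x))" "(\<integral>x. m n (T x) \<partial>M) = integral\<^sup>L M (m n)" for n
    proof -
      have "integrable (distr M M T) (m n)" using m_int ergodic_measureD(3)[OF erg] by simp
      then show "integrable M (\<lambda>x. m n (T x))" by (simp add: integrable_distr_eq)
      show "(\<integral>x. m n (T x) \<partial>M) = integral\<^sup>L M (m n)"
        using integral_distr[OF T m[of n]] ergodic_measureD(3)[OF erg] by simp
    qed
    define A where "A = (\<lambda>n. {x \<in> space M. m n x > 0})"
    have A [measurable]: "A n \<in> sets M" for n unfolding A_def by measurable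
    define h where "h = (\<lambda>n x. indicator (A n) x * g x)"
    have h_int: "integrable M (h n)" for n
      unfolding h_def
      by (rule integrable_const_bound[where B = B])
        (auto simp: indicator_def B intro!: AE_I2 order_trans[OF abs_ge_zero B])
    have "integral\<^sup>L M (h (Suc n)) \<ge> 0" for n
    proof -
      have "0 \<le> integral\<^sup>L M (m (Suc n)) - integral\<^sup>L M (m n)"
        using integral_mono[OF m_int m_int, of n "Suc n"] birkhoff_max_mono_Suc[of T g n]
        unfolding m_def by simp
      also have "\<dots> = (\<integral>x. m (Suc n) x - m n (T x) \<partial>M)"
        using m_int mT by simp
      \<comment> \<open>On \<open>A (Suc n)\<close> the recursion gives equality; elsewhere
        \<open>m (Suc n)\<close> vanishes and \<open>m n (T x)\<close> is nonnegative.\<close>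
      also have "\<dots> \<le> integral\<^sup>L M (h (Suc n))"
      proof (rule integral_mono)
        fix x assume "x \<in> space M"
        then show "m (Suc n) x - m n (T x) \<le> h (Suc n) x"
          using birkhoff_max_nonneg[of T g n "T x"] unfolding h_def A_def m_def
          by (auto simp: indicator_def)
      qed (use m_int mT h_int in auto)
      finally show ?thesis .
    qed
    \<comment> \<open>The sets \<open>A n\<close> increase, and every point of \<open>E\<close> lies
      in one of them because some Birkhoff sum there is positive.\<close>
    moreover have "(\<lambda>n. integral\<^sup>L M (h n)) \<longlonglongrightarrow> integral\<^sup>L M g"
    proof (rule integral_dominated_convergence[where w = "\<lambda>x. B"])
      show "AE x in M. (\<lambda>n. h n x) \<longlonglongrightarrow> g x"
        using AE_E
      proof (rule AE_mp, intro AE_I2 impI)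
        fix x assume x: "x \<in> space M" "x \<in> E"
        then obtain n where "S n x > 0" unfolding E_def by (auto dest: spec[of _ 0])
        then have n: "m n x > 0" using birkhoff_sum_le_max[of g T x n] unfolding S_def m_def by simp
        have "h k x = g x" if "k \<ge> n" for k
          using birkhoff_max_mono[OF that, of T g x] n x(1) unfolding h_def A_def m_def by auto
        then show "(\<lambda>n. h n x) \<longlonglongrightarrow> g x"
          by (intro tendsto_eventually) (auto simp: eventually_sequentially)
      qed
    qed (auto simp: h_def indicator_def B intro!: AE_I2 order_trans[OF abs_ge_zero B])
    ultimately have "0 \<le> integral\<^sup>L M g"
      by (intro LIMSEQ_le_const[OF LIMSEQ_Suc[of "\<lambda>n. integral\<^sup>L M (h n)"]]) auto
    then show False using neg by simp
  qed
  ultimately have "AE x in M. x \<notin> E" using E by (simp add: prob_eq_0)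
  then show ?thesis
  proof (rule AE_mp, intro AE_I2 impI)
    fix x assume "x \<in> space M" "x \<notin> E"
    then show "\<exists>K. \<forall>n. (\<Sum>i<n. g ((T ^^ i) x)) \<le> K" unfolding E_def S_def using not_less by blast
  qed
qed

text \<open>For each \<open>e = 1 / (k + 1)\<close> the functions
  \<open>indicator A - prob A - e\<close> and \<open>prob A - indicator A - e\<close> have integral
  \<open>-e\<close>, so their sums are bounded above almost everywhere. The counts then differ from
  \<open>n * prob A\<close> by at most \<open>n * e + K\<close>; countably many \<open>e\<close>
  suffice.\<close>

lemma ergodic_average_indicator:
  assumes erg: "ergodic_measure M T" and A [measurable]: "A \<in> sets M"
  shows "AE x in M. (\<lambda>N. (\<Sum>i<N. indicator A ((T ^^ i) x)) / real N) \<longlonglongrightarrow> measure M A"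
proof -
  interpret prob_space M using ergodic_measureD(1)[OF erg] .
  let ?S = "\<lambda>N x. \<Sum>i<N. indicator A ((T ^^ i) x) :: real"
  have "AE x in M. \<exists>K. \<forall>n. \<bar>?S n x - real n * prob A\<bar> \<le> real n / real (Suc k) + K" for k
  proof -
    define e where "e = 1 / real (Suc k)"
    have e: "0 < e" "e \<le> 1" by (auto simp: e_def)
    have "AE x in M. \<exists>K. \<forall>n. (\<Sum>i<n. s * (indicator A ((T ^^ i) x) - prob A) - e) \<le> K"
      if s: "\<bar>s\<bar> = 1" for s
    proof (rule ergodic_birkhoff_sum_bounded_above[OF erg, where B = 3])
      show "\<bar>s * (indicator A x - prob A) - e\<bar> \<le> 3" for x
      proof -
        have "\<bar>s * (indicator A x - prob A)\<bar> \<le> 1"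
          unfolding abs_mult s using prob_le_1[of A] measure_nonneg[of M A] by (auto simp: indicator_def)
        then show ?thesis using e by linarith
      qed
      show "(\<integral>x. s * (indicator A x - prob A) - e \<partial>M) < 0"
      proof -
        have "integrable M (\<lambda>x. indicator A x - prob A)"
          "(\<integral>x. indicator A x - prob A \<partial>M) = 0"
          by (simp_all add: Bochner_Integration.integral_diff emeasure_eq_measure prob_space)
        then show ?thesis using e by (simp add: Bochner_Integration.integral_diff prob_space)
      qed
    qed measurable
    from this[of 1, simplified abs_one, OF refl] this[of "-1", simplified abs_minus_cancel abs_one, OF refl] show ?thesis
    proof eventually_elim
      case (elim x)
      then obtain K K' where K: "\<And>n. (\<Sum>i<n. 1 * (indicator A ((T ^^ i) x) - prob A) - e) \<le> K"
        "\<And>n. (\<Sum>i<n. - 1 * (indicator A ((T ^^ i) x) - prob A) - e) \<le> K'" by auto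
      have "\<bar>?S n x - real n * prob A\<bar> \<le> real n / real (Suc k) + max K K'" for n
      proof -
        have "real n / real (Suc k) = real n * e" by (simp add: e_def)
        moreover have "?S n x - real n * prob A - real n * e \<le> K"
          using K(1)[of n] by (simp add: sum_subtractf)
        moreover have "real n * prob A - ?S n x - real n * e \<le> K'"
          using K(2)[of n] by (simp add: sum_subtractf)
        ultimately show ?thesis by linarith
      qed
      then show ?case by blast
    qed
  qed
  then have "AE x in M. \<forall>k. \<exists>K. \<forall>n. \<bar>?S n x - real n * prob A\<bar> \<le> real n / real (Suc k) + K"
    by (simp add: AE_all_countable)
  then show ?thesis
  proof eventually_elim
    case (elim x)
    show ?case
    proof (rule LIMSEQ_I)
      fix r :: real assume "r > 0"
      then obtain k where k: "1 / real (Suc k) < r / 2" using nat_approx_posE[of "r/2"] by auto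
      obtain K where K: "\<And>n. \<bar>?S n x - real n * prob A\<bar> \<le> real n / real (Suc k) + K" using elim by blast
      obtain n0 where n0: "real n0 > 2 * \<bar>K\<bar> / r" using reals_Archimedean2 by blast
      show "\<exists>no. \<forall>n\<ge>no. norm (?S n x / real n - prob A) < r"
      proof (intro exI[of _ "Suc n0"] allI impI)
        fix n assume n: "Suc n0 \<le> n"
        then have n': "real n > 0" "real n > real n0" by auto
        have "2 * \<bar>K\<bar> < real n0 * r" using n0 \<open>r > 0\<close> by (simp add: field_simps)
        also have "\<dots> \<le> real n * r" using n' \<open>r > 0\<close> by simp
        finally have "\<bar>K\<bar> < real n * r / 2" by simp
        moreover have "real n / real (Suc k) < real n * r / 2"
          using mult_strict_left_mono[OF k n'(1)] by simp
        ultimately have "\<bar>?S n x - real n * prob A\<bar> < real n * r" using K[of n] by linarith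
        moreover have "?S n x / real n - prob A = (?S n x - real n * prob A) / real n"
          using n' by (simp add: field_simps)
        ultimately show "norm (?S n x / real n - prob A) < r"
          using n' by (simp add: field_simps)
      qed
    qed
  qed
qed

section \<open>Cells of the fundamental square\<close>

definition open_square :: "complex set" where
  "open_square = {z. \<bar>Re z\<bar> < 1/2 \<and> \<bar>Im z\<bar> < 1/2}"

text \<open>All inequalities are strict, so the relation is not reflexive:
  \<open>same_cell z z\<close> says that \<open>z\<close> is in the open square and on none of the
  circles.\<close>

definition same_cell :: "complex \<Rightarrow> complex \<Rightarrow> bool" where
  "same_cell u v \<longleftrightarrow> u \<in> open_square \<and> v \<in> open_square \<and>
     (\<forall>c\<in>gauss_int. (norm (u - c) < 1 \<and> norm (v - c) < 1) \<or> (norm (u - c) > 1 \<and> norm (v - c) > 1))"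

lemma open_square_norm:
  assumes "z \<in> open_square"
  shows "(norm z)\<^sup>2 \<le> 1/2"
proof -
  have "(Re z)\<^sup>2 \<le> (1/2)\<^sup>2" "(Im z)\<^sup>2 \<le> (1/2)\<^sup>2"
    using assms unfolding open_square_def abs_le_square_iff[symmetric] by auto
  then show ?thesis unfolding cmod_power2 by (simp add: power2_eq_square)
qed

section \<open>Unit circles around Gaussian integers under inversion\<close>

lemma norm_less_1_iff: "norm z < 1 \<longleftrightarrow> (Re z)\<^sup>2 + (Im z)\<^sup>2 < 1"
  by (simp add: cmod_def)

lemma norm_gt_1_iff: "norm z > 1 \<longleftrightarrow> (Re z)\<^sup>2 + (Im z)\<^sup>2 > 1"
  by (simp add: cmod_def)

lemma norm_gt_1I: "\<bar>Re z\<bar> > 1 \<or> \<bar>Im z\<bar> > 1 \<Longrightarrow> norm z > 1"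
  using abs_Re_le_cmod[of z] abs_Im_le_cmod[of z] by linarith

text \<open>Multiply by \<open>norm w\<close>, square and expand. If \<open>norm c = 1\<close>, the
  quadratic term vanishes and a half plane remains; if \<open>(norm c)\<^sup>2 = 2\<close>, the
  expression describes the unit circle around \<open>cnj c\<close>.\<close>

lemma norm_inverse_minus_less_1_iff:
  fixes w c :: complex
  assumes "w \<noteq> 0"
  shows "norm (inverse w - c) < 1 \<longleftrightarrow> 1 - 2 * Re (c * w) + ((norm c)\<^sup>2 - 1) * (norm w)\<^sup>2 < 0"
    and "norm (inverse w - c) > 1 \<longleftrightarrow> 1 - 2 * Re (c * w) + ((norm c)\<^sup>2 - 1) * (norm w)\<^sup>2 > 0"
proof -
  have "inverse w - c = (1 - c * w) / w" using assms by (simp add: field_simps)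
  then have n: "norm (inverse w - c) = norm (1 - c * w) / norm w" by (simp add: norm_divide)
  have sq: "(norm (1 - c * w))\<^sup>2 - (norm w)\<^sup>2 = 1 - 2 * Re (c * w) + ((norm c)\<^sup>2 - 1) * (norm w)\<^sup>2"
    unfolding cmod_power2 by (simp add: power2_eq_square algebra_simps)
  have w: "norm w > 0" using assms by simp
  have "norm (inverse w - c) < 1 \<longleftrightarrow> (norm (1 - c * w))\<^sup>2 < (norm w)\<^sup>2"
    unfolding n using w by simp
      (metis norm_ge_zero power_less_imp_less_base power_strict_mono pos2)
  then show "norm (inverse w - c) < 1 \<longleftrightarrow> 1 - 2 * Re (c * w) + ((norm c)\<^sup>2 - 1) * (norm w)\<^sup>2 < 0"
    using sq by linarith
  have "norm (inverse w - c) > 1 \<longleftrightarrow> (norm (1 - c * w))\<^sup>2 > (norm w)\<^sup>2"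
    unfolding n using w by simp
      (metis norm_ge_zero power_less_imp_less_base power_strict_mono pos2)
  then show "norm (inverse w - c) > 1 \<longleftrightarrow> 1 - 2 * Re (c * w) + ((norm c)\<^sup>2 - 1) * (norm w)\<^sup>2 > 0"
    using sq by linarith
qed

text \<open>The four lines carrying the sides of the square invert to the unit circles around the
  four units.\<close>

lemma inverse_in_open_square_iff:
  assumes "w \<noteq> 0"
  shows "inverse w \<in> open_square \<longleftrightarrow>
    norm (w - 1) > 1 \<and> norm (w + 1) > 1 \<and> norm (w - \<i>) > 1 \<and> norm (w + \<i>) > 1"
proof -
  have p: "(Re w)\<^sup>2 + (Im w)\<^sup>2 > 0" using assms by (simp add: complex_eq_iff sum_power2_gt_zero_iff)
  have "\<bar>Re w / ((Re w)\<^sup>2 + (Im w)\<^sup>2)\<bar> < 1/2 \<longleftrightarrow> 2 * \<bar>Re w\<bar> < (Re w)\<^sup>2 + (Im w)\<^sup>2"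
    "\<bar>Im w / ((Re w)\<^sup>2 + (Im w)\<^sup>2)\<bar> < 1/2 \<longleftrightarrow> 2 * \<bar>Im w\<bar> < (Re w)\<^sup>2 + (Im w)\<^sup>2"
    using p by (simp_all add: field_simps)
  then have "inverse w \<in> open_square \<longleftrightarrow> 2 * \<bar>Re w\<bar> < (Re w)\<^sup>2 + (Im w)\<^sup>2 \<and> 2 * \<bar>Im w\<bar> < (Re w)\<^sup>2 + (Im w)\<^sup>2"
    unfolding open_square_def by simp
  also have "\<dots> \<longleftrightarrow> norm (w - 1) > 1 \<and> norm (w + 1) > 1 \<and> norm (w - \<i>) > 1 \<and> norm (w + \<i>) > 1"
    unfolding norm_gt_1_iff by (auto simp: power2_eq_square algebra_simps)
  finally show ?thesis .
qed

text \<open>The cases are separated by the unit circle around \<open>c\<close>: for 0 it encloses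
  the open square, for units it inverts to a line, for squared norm 2 to another such circle, and in
  the last case its disc misses the square.\<close>

lemma gauss_int_cases:
  assumes "c \<in> gauss_int"
  obtains "c = 0" | "c \<in> {1, -1}" | "c \<in> {\<i>, -\<i>}" | "(norm c)\<^sup>2 = 2" | "\<bar>Re c\<bar> \<ge> 2 \<or> \<bar>Im c\<bar> \<ge> 2"
proof -
  obtain m n :: int where c: "c = Complex (of_int m) (of_int n)"
    using assms by (auto simp: gauss_int_def complex_eq_iff elim!: Ints_cases)
  consider "\<bar>m\<bar> \<ge> 2 \<or> \<bar>n\<bar> \<ge> 2" | "m \<in> {-1,0,1}" "n \<in> {-1,0,1}" by fastforce
  then show ?thesis
  proof cases
    case 1
    then have "\<bar>Re c\<bar> \<ge> 2 \<or> \<bar>Im c\<bar> \<ge> 2" unfolding c by (auto simp flip: of_int_abs)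
    then show ?thesis using that(5) by blast
  next
    case 2
    then show ?thesis using that(1-4) unfolding c cmod_power2 by (auto simp: complex_eq_iff)
  qed
qed

text \<open>Inversion permutes the unit circles around the Gaussian integers of norm 2 and exchanges those
  around the units with the lines bounding the square.\<close>

lemma same_cell_inverse:
  assumes w: "w \<noteq> 0" "w' \<noteq> 0" and sq: "inverse w \<in> open_square" "inverse w' \<in> open_square"
    and circ: "\<And>c. c \<in> gauss_int \<Longrightarrow> (norm c)\<^sup>2 = 2 \<Longrightarrow>
      (norm (w - c) < 1 \<and> norm (w' - c) < 1) \<or> (norm (w - c) > 1 \<and> norm (w' - c) > 1)"
    and Re: "\<And>s. s \<in> {1, -1} \<Longrightarrow> (s * Re w < 1/2 \<and> s * Re w' < 1/2) \<or> (s * Re w > 1/2 \<and> s * Re w' > 1/2)"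
    and Im: "\<And>s. s \<in> {1, -1} \<Longrightarrow> (s * Im w < 1/2 \<and> s * Im w' < 1/2) \<or> (s * Im w > 1/2 \<and> s * Im w' > 1/2)"
  shows "same_cell (inverse w) (inverse w')"
  unfolding same_cell_def
proof (intro conjI ballI sq)
  fix c assume c: "c \<in> gauss_int"
  let ?P = "\<lambda>v v' c. (norm (v - c) < 1 \<and> norm (v' - c) < 1) \<or> (norm (v - c) > 1 \<and> norm (v' - c) > 1)"
  note iff = norm_inverse_minus_less_1_iff[OF w(1)] norm_inverse_minus_less_1_iff[OF w(2)]
  from c show "?P (inverse w) (inverse w') c"
  proof (cases rule: gauss_int_cases)
    case 1
    have "norm v < 1" if "v \<in> open_square" for v
      using open_square_norm[OF that] unfolding norm_less_1_iff cmod_power2 by simp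
    then show ?thesis using sq 1 by simp
  next
    case 2
    then show ?thesis using Re[of "Re c"] unfolding iff by auto
  next
    case 3
    then show ?thesis using Im[of "- Im c"] unfolding iff by auto
  next
    case 4
    have cc: "cnj c \<in> gauss_int" using c by (simp add: gauss_int_def)
    have eq: "1 - 2 * Re (c * v) + ((norm c)\<^sup>2 - 1) * (norm v)\<^sup>2 = (Re (v - cnj c))\<^sup>2 + (Im (v - cnj c))\<^sup>2 - 1" for v
    proof -
      have "(Re c)\<^sup>2 + (Im c)\<^sup>2 = 2" using 4 by (simp add: cmod_power2)
      then show ?thesis unfolding 4 unfolding cmod_power2 by (simp add: power2_eq_square algebra_simps)
    qed
    show ?thesis using circ[OF cc] 4 unfolding iff eq unfolding norm_less_1_iff norm_gt_1_iff by auto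
  next
    case 5
    have "norm (v - c) > 1" if "v \<in> open_square" for v
      using that 5 unfolding open_square_def by (intro norm_gt_1I) auto
    then show ?thesis using sq by blast
  qed
qed

text \<open>Integer translates of the interval from -1/2 to 1/2 have half-integers as endpoints, so
  none of them crosses 1/2 or -1/2.\<close>

lemma Ints_half_plane:
  fixes a b n s :: real
  assumes "n \<in> \<int>" "\<bar>a\<bar> < 1/2" "\<bar>b\<bar> < 1/2" "s \<in> {1, -1}"
  shows "(s * (n + a) < 1/2 \<and> s * (n + b) < 1/2) \<or> (s * (n + a) > 1/2 \<and> s * (n + b) > 1/2)"
proof -
  obtain k :: int where k: "n = of_int k" using assms(1) by (auto elim: Ints_cases)
  have "k \<le> -1 \<or> k = 0 \<or> k \<ge> 1" by linarith
  then have "n \<le> -1 \<or> n = 0 \<or> n \<ge> 1" unfolding k by auto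
  then show ?thesis using assms by auto
qed

text \<open>Translation by \<open>b\<close> permutes the circles, so \<open>b + u\<close> and
  \<open>b + v\<close> are on the same side of each. That the inverse lies in the open square is a
  condition on four of these circles, hence it passes from \<open>u\<close> to
  \<open>v\<close>.\<close>

lemma same_cell_step:
  assumes uv: "same_cell u v" and b: "b \<in> gauss_int"
    and sq: "inverse (b + u) \<in> open_square" and nz: "b + u \<noteq> 0"
  shows "same_cell (inverse (b + u)) (inverse (b + v))"
proof -
  have circ: "(norm (b + u - c) < 1 \<and> norm (b + v - c) < 1) \<or> (norm (b + u - c) > 1 \<and> norm (b + v - c) > 1)"
    if "c \<in> gauss_int" for c
  proof -
    have "c - b \<in> gauss_int" using b that by (simp add: gauss_int_def)
    moreover have "x - (c - b) = b + x - c" for x by simp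
    ultimately show ?thesis using uv unfolding same_cell_def by metis
  qed
  have "{1, -1, \<i>, -\<i>} \<subseteq> gauss_int" by (auto simp: gauss_int_def)
  then have g: "1 \<in> gauss_int" "-1 \<in> gauss_int" "\<i> \<in> gauss_int" "-\<i> \<in> gauss_int" by auto
  have far: "norm (b + u - 1) > 1" "norm (b + u - (- 1)) > 1" "norm (b + u - \<i>) > 1" "norm (b + u - (- \<i>)) > 1"
    using sq unfolding inverse_in_open_square_iff[OF nz] by auto
  have far': "norm (b + v - 1) > 1" "norm (b + v - (- 1)) > 1" "norm (b + v - \<i>) > 1" "norm (b + v - (- \<i>)) > 1"
    using circ[OF g(1)] circ[OF g(2)] circ[OF g(3)] circ[OF g(4)] far by linarith+
  then have nz': "b + v \<noteq> 0" by (intro notI) simp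
  have "inverse (b + v) \<in> open_square" unfolding inverse_in_open_square_iff[OF nz'] using far' by simp
  moreover have "\<bar>Re u\<bar> < 1/2" "\<bar>Re v\<bar> < 1/2" "\<bar>Im u\<bar> < 1/2" "\<bar>Im v\<bar> < 1/2" "Re b \<in> \<int>" "Im b \<in> \<int>"
    using uv b unfolding same_cell_def open_square_def gauss_int_def by auto
  ultimately show ?thesis
    using circ Ints_half_plane by (intro same_cell_inverse nz nz' sq) (auto simp del: divide_less_eq_1)
qed

text \<open>The modulus of \<open>3 + u\<close> is at least 5/2, so its inverse has modulus at most
  2/5. Equality is allowed in the hypothesis so that limits of points of the open square are
  covered.\<close>

lemma inverse_3_in_open_square:
  assumes "\<bar>Re u\<bar> \<le> 1/2"
  shows "inverse (3 + u) \<in> open_square"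
proof -
  have w: "Re (3 + u) \<ge> 5/2" using assms by simp
  then have "norm (3 + u) \<ge> 5/2" using complex_Re_le_cmod[of "3 + u"] by linarith
  then have "norm (inverse (3 + u)) \<le> 2/5"
    using le_imp_inverse_le[of "5/2" "norm (3 + u)"] unfolding norm_inverse by simp
  then show ?thesis
    using abs_Re_le_cmod[of "inverse (3 + u)"] abs_Im_le_cmod[of "inverse (3 + u)"]
    unfolding open_square_def by simp
qed

text \<open>The translate of the square by 3 lies to the right of real part 5/2, at distance more
  than 1 from every \<open>c\<close> of squared norm 2, and crosses none of the four lines bounding
  the square. A digit 3 therefore forgets which cell follows it.\<close>

lemma same_cell_3:
  assumes "u \<in> open_square" "v \<in> open_square"
  shows "same_cell (inverse (3 + u)) (inverse (3 + v))"
proof -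
  have uv: "\<bar>Re u\<bar> < 1/2" "\<bar>Re v\<bar> < 1/2" "\<bar>Im u\<bar> < 1/2" "\<bar>Im v\<bar> < 1/2"
    using assms unfolding open_square_def by auto
  then have nz: "3 + u \<noteq> 0" "3 + v \<noteq> 0" by (auto simp: complex_eq_iff)
  show ?thesis
  proof (rule same_cell_inverse[OF nz])
    fix c assume c: "c \<in> gauss_int" "(norm c)\<^sup>2 = 2"
    have "Re c < 3/2"
    proof (rule ccontr)
      assume "\<not> Re c < 3/2"
      then have "(3/2)\<^sup>2 \<le> (Re c)\<^sup>2" by (intro power_mono) auto
      then show False using c(2) unfolding cmod_power2 using zero_le_power2[of "Im c"] by (simp add: power_divide)
    qed
    then have "Re (3 + u - c) > 1" "Re (3 + v - c) > 1" using uv by auto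
    then show "(norm (3 + u - c) < 1 \<and> norm (3 + v - c) < 1) \<or> (norm (3 + u - c) > 1 \<and> norm (3 + v - c) > 1)"
      using norm_gt_1I[of "3 + u - c"] norm_gt_1I[of "3 + v - c"] by linarith
  qed (use uv inverse_3_in_open_square in auto)
qed

text \<open>The difference of the inverses is \<open>w' - w\<close> times both inverses, and each
  inverse has squared modulus at most 1/2.\<close>

lemma inverse_contraction:
  fixes w w' :: complex
  assumes "inverse w \<in> open_square" "inverse w' \<in> open_square" "w \<noteq> 0" "w' \<noteq> 0"
  shows "norm (inverse w - inverse w') \<le> norm (w - w') / 2"
proof -
  have "inverse w - inverse w' = - (inverse w * (w - w') * inverse w')"
    using assms by (simp add: inverse_diff_inverse)
  then have "norm (inverse w - inverse w') = norm (inverse w) * norm (inverse w') * norm (w - w')"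
    by (simp add: norm_mult)
  moreover have "norm (inverse w) * norm (inverse w') \<le> 1/2"
    using open_square_norm[OF assms(1)] open_square_norm[OF assms(2)] sum_squares_bound[of "norm (inverse w)" "norm (inverse w')"]
    by (simp add: power2_eq_square)
  ultimately show ?thesis using mult_right_mono[of _ "1/2" "norm (w - w')"] by simp
qed

text \<open>Infinite descent on denominators: if \<open>v n = p / q\<close>, then
  \<open>v (Suc n) = q / p - d n\<close> has denominator \<open>p\<close>, whose squared modulus is
  at most half that of \<open>q\<close>. A nonzero Gaussian integer would end up with modulus below
  1.\<close>

lemma not_gauss_rat_of_infinite_expansion:
  fixes v d :: "nat \<Rightarrow> complex"
  assumes v: "\<And>n. v n * (d n + v (Suc n)) = 1" and d: "\<And>n. d n \<in> gauss_int"
    and sq: "\<And>n. v n \<in> open_square"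
  shows "v 0 \<notin> gauss_rat"
proof
  assume "v 0 \<in> gauss_rat"
  have descent: False if "q \<in> gauss_int" "v n * q \<in> gauss_int" "q \<noteq> 0" "(norm q)\<^sup>2 < 2 ^ m" for m n q
    using that
  proof (induction m arbitrary: n q)
    case 0
    obtain k l :: int where q: "q = Complex (of_int k) (of_int l)"
      using 0(1) by (auto simp: gauss_int_def complex_eq_iff elim!: Ints_cases)
    have "(k\<^sup>2 + l\<^sup>2) < 1" using 0(4) unfolding q cmod_power2 by simp (metis of_int_add of_int_less_1_iff of_int_power)
    then have "k\<^sup>2 + l\<^sup>2 = 0" using zero_le_power2[of k] zero_le_power2[of l] by linarith
    then show ?case using 0(3) unfolding q by (simp add: sum_power2_eq_zero_iff complex_eq_iff)
  next
    case (Suc m)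
    define p where "p = v n * q"
    have "v n \<noteq> 0" using v[of n] by auto
    then have p: "p \<in> gauss_int" "p \<noteq> 0" using Suc.prems unfolding p_def by auto
    have "v (Suc n) * p = q - d n * p"
      using arg_cong[OF v[of n], of "\<lambda>t. t * q"] unfolding p_def by (simp add: algebra_simps)
    moreover have "q - d n * p \<in> gauss_int"
      using p(1) Suc.prems(1) d[of n] unfolding gauss_int_def by auto
    moreover have "(norm p)\<^sup>2 < 2 ^ m"
    proof -
      have "(norm (v n))\<^sup>2 \<le> 1/2" by (rule open_square_norm[OF sq])
      then have "(norm (v n))\<^sup>2 * (norm q)\<^sup>2 \<le> 1/2 * (norm q)\<^sup>2" by (rule mult_right_mono) simp
      then show ?thesis using Suc.prems(4) unfolding p_def norm_mult power_mult_distrib by simp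
    qed
    ultimately show ?case using Suc.IH[of p "Suc n"] p by simp
  qed
  obtain a b c e :: int where r: "Re (v 0) = of_int a / of_int b" "b > 0" "Im (v 0) = of_int c / of_int e" "e > 0"
    using \<open>v 0 \<in> gauss_rat\<close> unfolding gauss_rat_def by (auto elim!: Rats_cases')
  define q :: complex where "q = of_int (b * e)"
  have "v 0 * q = Complex (of_int (a * e)) (of_int (c * b))"
    using r by (simp add: complex_eq_iff q_def)
  then have "v 0 * q \<in> gauss_int" by (simp add: gauss_int_def)
  moreover have "q \<in> gauss_int" "q \<noteq> 0" using r by (auto simp: q_def gauss_int_def)
  moreover obtain m where "(norm q)\<^sup>2 < 2 ^ m" using real_arch_pow[of 2] by auto
  ultimately show False using descent by blast
qed

section \<open>From formal expansions to Hurwitz digits\<close>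

lemma nearest_gauss_add:
  assumes "b \<in> gauss_int" "u \<in> open_square"
  shows "nearest_gauss (b + u) = b"
proof -
  obtain k l :: int where b: "b = Complex (of_int k) (of_int l)"
    using assms(1) by (auto simp: gauss_int_def complex_eq_iff elim!: Ints_cases)
  have "\<lfloor>of_int k + Re u + 1/2\<rfloor> = k" "\<lfloor>of_int l + Im u + 1/2\<rfloor> = l"
    using assms(2) unfolding open_square_def by (auto simp: floor_eq_iff abs_less_iff)
  then show ?thesis unfolding nearest_gauss_def b by simp
qed

lemma nearest_gauss_gauss_int: "nearest_gauss z \<in> gauss_int"
  by (simp add: nearest_gauss_def gauss_int_def)

lemma open_square_subset: "open_square \<subseteq> hurwitz_domain"
  by (auto simp: open_square_def hurwitz_domain_def)

text \<open>A tail in the open square is exactly what rounding removes, so an expansion all of whose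
  tails lie there is the Hurwitz expansion of its value; no separate admissibility check on the
  digits remains.\<close>

lemma hurwitz_orbit_of_expansion:
  assumes v: "\<And>n. v n * (d n + v (Suc n)) = 1" and d: "\<And>n. d n \<in> gauss_int"
    and sq: "\<And>n. v n \<in> open_square"
  shows "(hurwitz_map ^^ n) (v 0) = v n" "nearest_gauss (inverse (v n)) = d n"
proof -
  have inv: "inverse (v n) = d n + v (Suc n)" for n
    using v[of n] by (simp add: inverse_unique)
  show *: "nearest_gauss (inverse (v n)) = d n" for n
    unfolding inv by (rule nearest_gauss_add[OF d sq])
  have "hurwitz_map (v n) = v (Suc n)" for n
    using v[of n] *[of n] inv[of n] by (auto simp: hurwitz_map_def)
  then show "(hurwitz_map ^^ n) (v 0) = v n"
    by (induction n) auto
qed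

section \<open>Splicing the digit 3 into an expansion\<close>

text \<open>The finite continued fraction with digits \<open>d n\<close>, ...,
  \<open>d (n + k - 1)\<close> and final tail \<open>t (n + k)\<close>. Ending in a tail of a
  typical orbit, rather than in 0, keeps the approximants inside the right cells.\<close>

primrec cf_approx :: "(nat \<Rightarrow> complex) \<Rightarrow> (nat \<Rightarrow> complex) \<Rightarrow> nat \<Rightarrow> nat \<Rightarrow> complex" where
  "cf_approx d t 0 n = t n"
| "cf_approx d t (Suc k) n = inverse (d n + cf_approx d t k (Suc n))"

lemma cf_approx_cong:
  assumes "\<And>i. n \<le> i \<Longrightarrow> i < n + k \<Longrightarrow> d i = d' i"
  shows "cf_approx d t k n = cf_approx d' t k n"
  using assms
proof (induction k arbitrary: n)
  case (Suc k)
  then show ?case using Suc.IH[of "Suc n"] Suc.prems[of n] by simp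
qed simp

text \<open>Here \<open>t\<close> is the orbit of a typical point and \<open>a\<close> its digits;
  \<open>t_cell\<close> says that the orbit stays off all walls. The product form of
  \<open>t_step\<close> also yields that no \<open>t n\<close> is 0.\<close>

locale cell_orbit =
  fixes t a :: "nat \<Rightarrow> complex"
  assumes t_step: "\<And>n. t n * (a n + t (Suc n)) = 1"
    and t_cell: "\<And>n. same_cell (t n) (t n)"
    and a_int: "\<And>n. a n \<in> gauss_int"
begin

definition splice :: "nat set \<Rightarrow> nat \<Rightarrow> complex" where
  "splice R n = (if n \<in> R then 3 else a n)"

text \<open>A run of overwritten digits may start only right after an original digit 3, which
  shields all earlier tails from the change. Returning from the run to the original digits is
  unrestricted.\<close>

definition spliceable :: "nat set \<Rightarrow> bool" where
  "spliceable R \<longleftrightarrow> (\<forall>n. n \<notin> R \<longrightarrow> Suc n \<in> R \<longrightarrow> a n = 3)"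

abbreviation approx :: "nat set \<Rightarrow> nat \<Rightarrow> nat \<Rightarrow> complex" where
  "approx R \<equiv> cf_approx (splice R) t"

lemma splice_int: "splice R n \<in> gauss_int"
  using a_int by (simp add: splice_def gauss_int_def)

lemma t_inverse: "t n = inverse (a n + t (Suc n))" "a n + t (Suc n) \<noteq> 0"
proof -
  have "(a n + t (Suc n)) * t n = 1" using t_step[of n] by (simp only: mult.commute)
  then show "t n = inverse (a n + t (Suc n))" "a n + t (Suc n) \<noteq> 0"
    by (auto dest: inverse_unique)
qed

lemma t_square: "t n \<in> open_square"
  using t_cell[of n] by (simp add: same_cell_def)

text \<open>The invariant carried backwards along the digits: the tail is in the open square and,
  off \<open>R\<close>, in the cell of the original tail. If \<open>n\<close> is in
  \<open>R\<close>, the digit 3 gives membership in the square; if a run starts at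
  \<open>Suc n\<close>, then \<open>a n = 3\<close> and \<open>same_cell_3\<close> applies;
  otherwise \<open>same_cell_step\<close> does.\<close>

lemma splice_step:
  assumes R: "spliceable R" and u: "u \<in> open_square" "Suc n \<notin> R \<Longrightarrow> same_cell (t (Suc n)) u"
  shows "inverse (splice R n + u) \<in> open_square" "n \<notin> R \<Longrightarrow> same_cell (t n) (inverse (splice R n + u))"
proof -
  have *: "same_cell (t n) (inverse (splice R n + u))" if n: "n \<notin> R"
  proof (cases "Suc n \<in> R")
    case True
    then have "a n = 3" using R n by (auto simp: spliceable_def)
    then show ?thesis using same_cell_3[OF t_square u(1)] t_inverse(1)[of n] n by (simp add: splice_def)
  next
    case False
    have "same_cell (inverse (a n + t (Suc n))) (inverse (a n + u))"
      using t_square[of n] t_inverse[of n] by (intro same_cell_step[OF u(2)[OF False] a_int]) auto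
    then show ?thesis using t_inverse(1)[of n] n by (simp add: splice_def)
  qed
  then show "n \<notin> R \<Longrightarrow> same_cell (t n) (inverse (splice R n + u))" .
  show "inverse (splice R n + u) \<in> open_square"
  proof (cases "n \<in> R")
    case True
    have "\<bar>Re u\<bar> \<le> 1/2" using u(1) by (simp add: open_square_def)
    then show ?thesis using inverse_3_in_open_square[of u] True by (simp add: splice_def)
  next
    case False
    then show ?thesis using * by (simp add: same_cell_def)
  qed
qed

lemma splice_nonzero:
  assumes R: "spliceable R" and u: "u \<in> open_square" "Suc n \<notin> R \<Longrightarrow> same_cell (t (Suc n)) u"
  shows "splice R n + u \<noteq> 0"
proof (cases "n \<in> R")
  case True
  then show ?thesis using u(1) by (auto simp: splice_def open_square_def complex_eq_iff)
next
  case False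
  then have "same_cell (t n) (inverse (splice R n + u))" using splice_step(2)[OF assms] by simp
  \<comment> \<open>If the sum were 0, so would be its inverse by convention; but 0 lies on the unit
    circle around 1 and belongs to no cell.\<close>
  moreover have "1 \<in> gauss_int" by (simp add: gauss_int_def)
  ultimately show ?thesis unfolding same_cell_def by fastforce
qed

lemma approx_cell:
  assumes "spliceable R"
  shows "approx R k n \<in> open_square \<and> (n \<notin> R \<longrightarrow> same_cell (t n) (approx R k n))"
proof (induction k arbitrary: n)
  case 0
  show ?case using t_square t_cell by simp
next
  case (Suc k)
  then show ?case using splice_step[OF assms, of "approx R k (Suc n)" n] by auto
qed

lemma approx_mult:
  assumes "spliceable R"
  shows "approx R (Suc k) n * (splice R n + approx R k (Suc n)) = 1"
  using approx_cell[OF assms, of k "Suc n"] splice_nonzero[OF assms, of "approx R k (Suc n)" n] by simp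

text \<open>Two points of the square are at distance at most 2, and each of the first
  \<open>k\<close> common digits halves the distance by \<open>inverse_contraction\<close>.\<close>

lemma approx_dist:
  assumes R: "spliceable R"
  shows "norm (approx R (k + j) n - approx R k n) \<le> 2 * (1/2) ^ k"
proof (induction k arbitrary: n)
  case 0
  have *: "norm z \<le> 1" if "z \<in> open_square" for z
    using open_square_norm[OF that] power2_le_imp_le[of "norm z" 1] by simp
  show ?case
    using *[of "approx R j n"] *[of "approx R 0 n"] approx_cell[OF R, of j n] approx_cell[OF R, of 0 n] norm_triangle_ineq4[of "approx R j n" "approx R 0 n"]
    by (simp del: cf_approx.simps)
next
  case (Suc k)
  have "norm (approx R (Suc k + j) n - approx R (Suc k) n)
      \<le> norm ((splice R n + approx R (k + j) (Suc n)) - (splice R n + approx R k (Suc n))) / 2"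
    using approx_cell[OF R, of "Suc k + j" n] approx_cell[OF R, of "Suc k" n]
      approx_cell[OF R, of "k + j" "Suc n"] approx_cell[OF R, of k "Suc n"]
      splice_nonzero[OF R, of "approx R (k + j) (Suc n)" n] splice_nonzero[OF R, of "approx R k (Suc n)" n]
      inverse_contraction[of "splice R n + approx R (k + j) (Suc n)" "splice R n + approx R k (Suc n)"]
    by auto
  also have "\<dots> \<le> 2 * (1/2) ^ Suc k" using Suc[of "Suc n"] by simp
  finally show ?case .
qed

definition spliced :: "nat set \<Rightarrow> nat \<Rightarrow> complex" where
  "spliced R n = lim (\<lambda>k. approx R k n)"

lemma approx_tendsto:
  assumes R: "spliceable R"
  shows "(\<lambda>k. approx R k n) \<longlonglongrightarrow> spliced R n"
proof -
  have "Cauchy (\<lambda>k. approx R k n)"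
  proof (rule metric_CauchyI)
    fix e :: real assume "0 < e"
    then obtain K where K: "(1/2) ^ K < e / 4" using real_arch_pow_inv[of "e/4" "1/2"] by auto
    have "dist (approx R m n) (approx R K n) < e / 2" if "m \<ge> K" for m
      using approx_dist[OF R, of K "m - K" n] that K by (simp add: dist_norm)
    then show "\<exists>M. \<forall>m\<ge>M. \<forall>l\<ge>M. dist (approx R m n) (approx R l n) < e"
      by (meson dist_triangle_half_l dist_commute)
  qed
  then show ?thesis unfolding spliced_def using Cauchy_convergent convergent_LIMSEQ_iff by blast
qed

lemma spliced_step:
  assumes R: "spliceable R"
  shows "spliced R n * (splice R n + spliced R (Suc n)) = 1"
proof (rule LIMSEQ_unique)
  show "(\<lambda>k. approx R (Suc k) n * (splice R n + approx R k (Suc n))) \<longlonglongrightarrow> spliced R n * (splice R n + spliced R (Suc n))"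
    by (intro tendsto_intros approx_tendsto[OF R] LIMSEQ_Suc[OF approx_tendsto[OF R]])
  show "(\<lambda>k. approx R (Suc k) n * (splice R n + approx R k (Suc n))) \<longlonglongrightarrow> 1"
    unfolding approx_mult[OF R] by simp
qed

lemma spliced_dist:
  assumes R: "spliceable R"
  shows "norm (spliced R n - approx R k n) \<le> 2 * (1/2) ^ k"
proof (rule LIMSEQ_le_const2)
  show "(\<lambda>j. norm (approx R (j + k) n - approx R k n)) \<longlonglongrightarrow> norm (spliced R n - approx R k n)"
    by (intro tendsto_intros LIMSEQ_ignore_initial_segment approx_tendsto[OF R])
  show "\<exists>N. \<forall>j\<ge>N. norm (approx R (j + k) n - approx R k n) \<le> 2 * (1/2) ^ k"
    using approx_dist[OF R, of k _ n] by (auto simp: add.commute)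
qed

text \<open>Both points share the \<open>k\<close>-th approximant, since digits below
  \<open>k\<close> and the final tail \<open>t k\<close> agree; each is within
  \<open>2 * (1/2) ^ k\<close> of it.\<close>

lemma spliced_dist_spliced:
  assumes R: "spliceable R" "spliceable R'" and eq: "\<And>i. i < k \<Longrightarrow> i \<in> R \<longleftrightarrow> i \<in> R'"
  shows "norm (spliced R 0 - spliced R' 0) \<le> 4 * (1/2) ^ k"
proof -
  have "approx R k 0 = approx R' k 0"
    by (rule cf_approx_cong) (simp add: splice_def eq)
  then show ?thesis
    using spliced_dist[OF R(1), of 0 k] spliced_dist[OF R(2), of 0 k]
      norm_triangle_ineq4[of "spliced R 0 - approx R k 0" "spliced R' 0 - approx R' k 0"] by simp
qed

text \<open>A limit of points of the open square may a priori lie on its boundary; the digit 3 moves it back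
  inside, and from there the interior position propagates to all earlier indices.\<close>

lemma spliced_square:
  assumes R: "spliceable R" and inf: "\<And>m. \<exists>n\<ge>m. n \<in> R"
  shows "spliced R m \<in> open_square"
proof -
  obtain p where p: "p \<ge> m" "p \<in> R" using inf by blast
  have inv: "spliced R n = inverse (splice R n + spliced R (Suc n))" for n
    using inverse_unique[of "splice R n + spliced R (Suc n)" "spliced R n"] spliced_step[OF R, of n]
    by (simp add: mult.commute)
  have "\<bar>Re (spliced R (Suc p))\<bar> \<le> 1/2"
  proof (rule LIMSEQ_le_const2)
    show "(\<lambda>k. \<bar>Re (approx R k (Suc p))\<bar>) \<longlonglongrightarrow> \<bar>Re (spliced R (Suc p))\<bar>"
      by (intro tendsto_intros approx_tendsto[OF R])
    show "\<exists>N. \<forall>k\<ge>N. \<bar>Re (approx R k (Suc p))\<bar> \<le> 1/2"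
      using approx_cell[OF R, of _ "Suc p"] unfolding open_square_def by (auto intro: less_imp_le)
  qed
  then have "spliced R p \<in> open_square"
    using inverse_3_in_open_square p(2) inv[of p] by (simp add: splice_def)
  with p(1) p(2) have "spliced R m \<in> open_square \<and> (m \<notin> R \<longrightarrow> same_cell (t m) (spliced R m))"
  proof (induction rule: inc_induct)
    case (step n)
    then show ?case
      using splice_step[OF R, of "spliced R (Suc n)" n] inv[of n] by auto
  qed simp
  then show ?thesis by blast
qed

end

section \<open>Counting words\<close>

definition word_count :: "(nat \<Rightarrow> complex) \<Rightarrow> complex list \<Rightarrow> nat \<Rightarrow> nat" where
  "word_count d b N = card {j. j < N \<and> (\<forall>i<length b. d (j + i) = b ! i)}"

lemma hurwitz_normal_iff_word_count:
  assumes "z \<in> hurwitz_domain" "z \<notin> gauss_rat"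
    and d: "\<And>n. nearest_gauss (inverse ((hurwitz_map ^^ n) z)) = d n"
  shows "z \<in> hurwitz_normal \<mu> \<longleftrightarrow> (\<forall>b. b \<noteq> [] \<longrightarrow> regular_word b \<longrightarrow>
    (\<lambda>N. real (word_count d b N) / real N) \<longlonglongrightarrow> measure \<mu> (hurwitz_cylinder b))"
proof -
  have iff: "map (\<lambda>k. hurwitz_quotient (j + k) z) [1..<length b + 1] = b \<longleftrightarrow> (\<forall>i<length b. d (j + i) = b ! i)" for b j
  proof -
    \<comment> \<open>Entry \<open>i\<close> of the index list is \<open>i + 1\<close>, and
      \<open>hurwitz_quotient\<close> subtracts 1 again: \<open>d\<close> is indexed from 0, the
      quotients from 1.\<close>
    have "hurwitz_quotient (j + [1..<length b + 1] ! i) z = d (j + i)" if "i < length b" for i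
      using that d[of "j + i"] by (simp add: hurwitz_quotient_def del: upt_Suc)
    then show ?thesis by (subst list_eq_iff_nth_eq) (simp del: upt_Suc)
  qed
  have count: "card {j \<in> {0..<N}. map (\<lambda>k. hurwitz_quotient (j + k) z) [1..<length b + 1] = b} = word_count d b N" for N b
    unfolding iff word_count_def by simp
  have "z \<in> hurwitz_normal \<mu> \<longleftrightarrow> (\<forall>b. length b \<ge> 1 \<longrightarrow> regular_word b \<longrightarrow>
    (\<lambda>N. real (card {j \<in> {0..<N}. map (\<lambda>k. hurwitz_quotient (j + k) z) [1..<length b + 1] = b}) / real N)
       \<longlonglongrightarrow> measure \<mu> (hurwitz_cylinder b))"
    unfolding hurwitz_normal_def using assms(1,2) by blast
  then show ?thesis unfolding count by (simp add: Suc_le_eq)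
qed

text \<open>The orbit is in the cylinder of \<open>b\<close> at time \<open>j\<close> exactly when
  \<open>b\<close> occurs at position \<open>j\<close>, so Birkhoff averages of cylinders are word
  frequencies.\<close>

lemma sum_indicator_cylinder_eq_word_count:
  assumes z: "z \<in> hurwitz_domain" and nz: "\<And>n. (hurwitz_map ^^ n) z \<noteq> 0"
    and d: "\<And>n. nearest_gauss (inverse ((hurwitz_map ^^ n) z)) = d n"
  shows "(\<Sum>j<N. indicator (hurwitz_cylinder b) ((hurwitz_map ^^ j) z)) = real (word_count d b N)"
proof -
  have dom: "(hurwitz_map ^^ j) z \<in> hurwitz_domain" for j
    using z hurwitz_map_in_domain by (cases j) auto
  have shift: "(hurwitz_map ^^ i) ((hurwitz_map ^^ j) z) = (hurwitz_map ^^ (j + i)) z" for i j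
    by (simp add: funpow_add add.commute[of j])
  have "(hurwitz_map ^^ j) z \<in> hurwitz_cylinder b \<longleftrightarrow> (\<forall>i<length b. d (j + i) = b ! i)" for j
  proof -
    have "(hurwitz_map ^^ j) z \<in> hurwitz_cylinder b \<longleftrightarrow> (\<forall>i\<in>{1..length b}. d (j + (i - 1)) = b ! (i - 1))"
      unfolding hurwitz_cylinder_def hurwitz_quotient_def using nz dom by (simp add: shift d)
    also have "\<dots> \<longleftrightarrow> (\<forall>i<length b. d (j + i) = b ! i)"
    proof -
      have "{1..length b} = Suc ` {..<length b}" by (auto simp: image_Suc_lessThan)
      then show ?thesis by auto
    qed
    finally show ?thesis .
  qed
  then have "(\<Sum>j<N. indicator (hurwitz_cylinder b) ((hurwitz_map ^^ j) z))
      = (\<Sum>j<N. if \<forall>i<length b. d (j + i) = b ! i then 1 else (0::real))"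
    by (simp add: indicator_def of_bool_def)
  also have "\<dots> = real (word_count d b N)"
    unfolding word_count_def by (subst sum.inter_filter[symmetric]) auto
  finally show ?thesis .
qed

text \<open>An occurrence can appear or vanish only if its window meets \<open>R\<close>. Each
  position lies in at most \<open>length b\<close> windows, and windows starting below
  \<open>N\<close> reach fewer than \<open>length b\<close> positions beyond it.\<close>

lemma word_count_diff:
  assumes "\<And>n. n \<notin> R \<Longrightarrow> d n = d' n"
  shows "\<bar>real (word_count d b N) - real (word_count d' b N)\<bar> \<le> real (length b) * (real (card (R \<inter> {..<N})) + real (length b))"
proof -
  define D where "D = {j. j < N \<and> (\<exists>i<length b. j + i \<in> R)}"
  have D: "card D \<le> length b * (card (R \<inter> {..<N}) + length b)"
  proof -
    have "D \<subseteq> (\<Union>i<length b. (\<lambda>m. m - i) ` ((R \<inter> {..<N}) \<union> {N..<N + length b}))"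
    proof
      fix j assume "j \<in> D"
      then obtain i where i: "j < N" "i < length b" "j + i \<in> R" by (auto simp: D_def)
      then have "j + i \<in> (R \<inter> {..<N}) \<union> {N..<N + length b}" by auto
      then have "j \<in> (\<lambda>m. m - i) ` ((R \<inter> {..<N}) \<union> {N..<N + length b})"
        by (rule rev_image_eqI) simp
      then show "j \<in> (\<Union>i<length b. (\<lambda>m. m - i) ` ((R \<inter> {..<N}) \<union> {N..<N + length b}))" using i by blast
    qed
    then have "card D \<le> card (\<Union>i<length b. (\<lambda>m. m - i) ` ((R \<inter> {..<N}) \<union> {N..<N + length b}))"
      by (intro card_mono) auto
    also have "\<dots> \<le> (\<Sum>i<length b. card ((\<lambda>m. m - i) ` ((R \<inter> {..<N}) \<union> {N..<N + length b})))"
      by (rule card_UN_le) simp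
    also have "\<dots> \<le> (\<Sum>i<length b. card (R \<inter> {..<N}) + length b)"
    proof (rule sum_mono)
      fix i
      have "card ((\<lambda>m. m - i) ` ((R \<inter> {..<N}) \<union> {N..<N + length b})) \<le> card ((R \<inter> {..<N}) \<union> {N..<N + length b})"
        by (rule card_image_le) simp
      also have "\<dots> \<le> card (R \<inter> {..<N}) + length b"
        using card_Un_le[of "R \<inter> {..<N}" "{N..<N + length b}"] by simp
      finally show "card ((\<lambda>m. m - i) ` ((R \<inter> {..<N}) \<union> {N..<N + length b})) \<le> card (R \<inter> {..<N}) + length b" .
    qed
    also have "\<dots> = length b * (card (R \<inter> {..<N}) + length b)" by simp
    finally show ?thesis .
  qed
  have le: "word_count e b N \<le> word_count e' b N + card D" if "\<And>n. n \<notin> R \<Longrightarrow> e n = e' n" for e e'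
  proof -
    have "{j. j < N \<and> (\<forall>i<length b. e (j + i) = b ! i)} \<subseteq> {j. j < N \<and> (\<forall>i<length b. e' (j + i) = b ! i)} \<union> D"
      using that by (auto simp: D_def)
    then have "word_count e b N \<le> card ({j. j < N \<and> (\<forall>i<length b. e' (j + i) = b ! i)} \<union> D)"
      unfolding word_count_def by (intro card_mono) (auto simp: D_def)
    also have "\<dots> \<le> word_count e' b N + card D" unfolding word_count_def by (rule card_Un_le)
    finally show ?thesis .
  qed
  have "\<bar>real (word_count d b N) - real (word_count d' b N)\<bar> \<le> real (card D)"
    using le[of d d'] le[of d' d] assms by fastforce
  also have "\<dots> \<le> real (length b) * (real (card (R \<inter> {..<N})) + real (length b))"
    using D by (metis of_nat_add of_nat_le_iff of_nat_mult)
  finally show ?thesis .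
qed

section \<open>Typical points\<close>

lemma open_open_square: "open open_square"
  unfolding open_square_def by (intro open_Collect_conj open_Collect_less continuous_intros)

lemma countable_gauss_int: "countable gauss_int"
proof -
  have "gauss_int \<subseteq> range (\<lambda>(m, n). Complex (of_int m) (of_int n))"
  proof
    fix z assume "z \<in> gauss_int"
    then obtain m n :: int where "z = Complex (of_int m) (of_int n)"
      by (auto simp: gauss_int_def complex_eq_iff elim!: Ints_cases)
    then show "z \<in> range (\<lambda>(m, n). Complex (of_int m) (of_int n))" by force
  qed
  then show ?thesis by (rule countable_subset) simp
qed

text \<open>Only the left and lower sides are listed, since the half-open square excludes the other
  two.\<close>

definition cell_walls :: "complex set" where
  "cell_walls = {z. Re z = -1/2} \<union> {z. Im z = -1/2} \<union> (\<Union>c\<in>gauss_int. sphere c 1)"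

lemma cell_walls_null: "cell_walls \<in> null_sets lborel"
proof -
  have "negligible {z::complex. Re z = -1/2}" "negligible {z::complex. Im z = -1/2}"
    using negligible_standard_hyperplane[of "1::complex" "-1/2"]
      negligible_standard_hyperplane[of \<i> "-1/2"] by (auto simp: Basis_complex_def inner_complex_def)
  then have "negligible cell_walls"
    unfolding cell_walls_def
    by (intro negligible_Un negligible_countable_Union countable_image countable_gauss_int)
      (auto simp: negligible_sphere)
  moreover have "cell_walls \<in> sets borel"
  proof -
    have "closed {z::complex. Re z = -1/2}" "closed {z::complex. Im z = -1/2}"
      by (intro closed_Collect_eq continuous_intros)+
    moreover have "(\<Union>c\<in>gauss_int. sphere c 1) \<in> sets (borel :: complex measure)"
      by (intro sets.countable_UN' countable_gauss_int) auto
    ultimately show ?thesis unfolding cell_walls_def by (auto intro!: sets.Un intro: borel_closed)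
  qed
  ultimately show ?thesis
    unfolding negligible_iff_null_sets by (simp add: null_sets_completion_iff)
qed

lemma same_cell_refl:
  assumes "z \<in> hurwitz_domain" "z \<notin> cell_walls"
  shows "same_cell z z"
proof -
  have "z \<in> open_square"
    using assms unfolding hurwitz_domain_def cell_walls_def open_square_def by (auto simp: abs_less_iff)
  moreover have "norm (z - c) \<noteq> 1" if "c \<in> gauss_int" for c
    using assms(2) that unfolding cell_walls_def by (auto simp: dist_norm norm_minus_commute)
  ultimately show ?thesis unfolding same_cell_def by fastforce
qed

lemma hurwitz_domain_borel: "hurwitz_domain \<in> sets borel"
proof -
  have "hurwitz_domain = {z \<in> space borel. - 1/2 \<le> Re z \<and> Re z < 1/2 \<and> - 1/2 \<le> Im z \<and> Im z < 1/2}"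
    by (simp add: hurwitz_domain_def)
  also have "\<dots> \<in> sets borel" by measurable
  finally show ?thesis .
qed

lemma nearest_gauss_measurable [measurable]: "nearest_gauss \<in> borel_measurable borel"
  unfolding borel_measurable_complex_iff nearest_gauss_def by simp

lemma nearest_gauss_inverse_3:
  assumes "nearest_gauss (inverse z) = 3"
  shows "Re z > 0"
proof -
  have "\<lfloor>Re (inverse z) + 1/2\<rfloor> = 3" using assms by (simp add: nearest_gauss_def complex_eq_iff del: inverse_complex.sel)
  then have "Re (inverse z) > 0" by linarith
  then show ?thesis by (simp add: zero_less_divide_iff add_nonneg_eq_0_iff) (smt (verit) zero_le_power2)
qed

lemma interior_cylinder_3: "interior (hurwitz_cylinder [3]) \<noteq> {}"
proof -
  \<comment> \<open>\<open>W\<close> is the part of the open square whose inverses lie in the open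
    square translated by 3, with denominators cleared so that openness is immediate.\<close>
  define W where "W = {z::complex. \<bar>Re z\<bar> < 1/2 \<and> \<bar>Im z\<bar> < 1/2 \<and>
    5/2 * ((Re z)\<^sup>2 + (Im z)\<^sup>2) < Re z \<and> Re z < 7/2 * ((Re z)\<^sup>2 + (Im z)\<^sup>2) \<and>
    \<bar>Im z\<bar> < 1/2 * ((Re z)\<^sup>2 + (Im z)\<^sup>2)}"
  have "open W" unfolding W_def by (intro open_Collect_conj open_Collect_less continuous_intros)
  moreover have "W \<subseteq> hurwitz_cylinder [3]"
  proof
    fix z assume z: "z \<in> W"
    have p: "(Re z)\<^sup>2 + (Im z)\<^sup>2 > 0" using z unfolding W_def by auto
    then have nz: "z \<noteq> 0" by auto
    have "inverse z - 3 \<in> open_square"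
    proof -
      let ?s = "(Re z)\<^sup>2 + (Im z)\<^sup>2"
      have "5/2 < Re z / ?s" "Re z / ?s < 7/2" "\<bar>Im z / ?s\<bar> < 1/2"
        using z p unfolding W_def by (simp_all add: pos_less_divide_eq pos_divide_less_eq)
      moreover have "Re (inverse z - 3) = Re z / ?s - 3" "Im (inverse z - 3) = - (Im z / ?s)" by simp_all
      ultimately show ?thesis unfolding open_square_def mem_Collect_eq by linarith
    qed
    moreover have "(3::complex) \<in> gauss_int" by (simp add: gauss_int_def)
    ultimately have "nearest_gauss (3 + (inverse z - 3)) = 3" by (intro nearest_gauss_add)
    moreover have "z \<in> hurwitz_domain" using z open_square_subset unfolding W_def open_square_def by auto
    ultimately show "z \<in> hurwitz_cylinder [3]"
      using nz by (simp add: hurwitz_cylinder_def hurwitz_quotient_def)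
  qed
  moreover have "1/3 \<in> W" by (simp add: W_def power2_eq_square)
  ultimately show ?thesis using interior_maximal by blast
qed

lemma regular_word_3: "regular_word [3]"
  using interior_cylinder_3 by (simp add: regular_word_def gauss_int_def)

section \<open>The Hurwitz measure and a typical orbit\<close>

context
  fixes \<mu> :: "complex measure"
  assumes hm: "is_hurwitz_measure \<mu>"
begin

lemma hm_ergodic: "ergodic_measure \<mu> hurwitz_map"
  using hm by (simp add: is_hurwitz_measure_def)

lemma hm_sets: "sets \<mu> = sets (restrict_space borel hurwitz_domain)"
  using hm by (simp add: is_hurwitz_measure_def)

lemma hm_space: "space \<mu> = hurwitz_domain"
  using sets_eq_imp_space_eq[OF hm_sets] by (simp add: space_restrict_space)

lemma hm_null_iff:
  assumes "A \<subseteq> hurwitz_domain" "A \<in> sets borel"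
  shows "A \<in> null_sets \<mu> \<longleftrightarrow> A \<in> null_sets lborel"
proof -
  have "null_sets \<mu> = null_sets (restrict_space lborel hurwitz_domain)"
    using hm by (auto simp: is_hurwitz_measure_def absolutely_continuous_def)
  then show ?thesis
    using assms hurwitz_domain_borel by (simp add: null_sets_restrict_space)
qed

lemma hm_sets_iff: "A \<in> sets \<mu> \<longleftrightarrow> A \<subseteq> hurwitz_domain \<and> A \<in> sets borel"
  unfolding hm_sets using hurwitz_domain_borel by (subst sets_restrict_space_iff) auto

lemma hm_funpow_measurable: "hurwitz_map ^^ n \<in> measurable \<mu> \<mu>"
  using ergodic_measureD(2)[OF hm_ergodic]
  by (induction n) (auto simp: comp_def intro: measurable_compose)

lemma hm_cylinder_sets: "hurwitz_cylinder b \<in> sets \<mu>"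
proof -
  have "(\<lambda>z. z) \<in> measurable \<mu> borel"
    using measurable_ident_sets[OF hm_sets] by (auto intro: measurable_restrict_space1 simp: measurable_cong_sets[OF hm_sets refl])
  then have [measurable]: "hurwitz_map ^^ n \<in> borel_measurable \<mu>" for n
    by (rule measurable_compose[OF hm_funpow_measurable])
  have "hurwitz_cylinder b = {z \<in> space \<mu>. \<forall>j\<in>{1..length b}.
      (hurwitz_map ^^ (j - 1)) z \<noteq> 0 \<and> nearest_gauss (inverse ((hurwitz_map ^^ (j - 1)) z)) = b ! (j - 1)}"
    by (simp add: hurwitz_cylinder_def hurwitz_quotient_def hm_space)
  also have "\<dots> \<in> sets \<mu>" by measurable
  finally show ?thesis .
qed

text \<open>The walls are a Lebesgue null set, hence null for \<open>\<mu>\<close>; invariance of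
  \<open>\<mu>\<close> makes their preimages under all iterates null as well.\<close>

lemma hm_AE_orbit_same_cell: "AE z in \<mu>. \<forall>n. same_cell ((hurwitz_map ^^ n) z) ((hurwitz_map ^^ n) z)"
  unfolding AE_all_countable
proof
  fix n
  have "cell_walls \<inter> hurwitz_domain \<in> null_sets lborel"
    using null_set_Int2[OF cell_walls_null, of hurwitz_domain] hurwitz_domain_borel by simp
  then have "cell_walls \<inter> hurwitz_domain \<in> null_sets \<mu>"
    by (subst hm_null_iff) auto
  then have 0: "AE z in \<mu>. same_cell z z"
    by (rule AE_I') (use same_cell_refl in \<open>auto simp: hm_space\<close>)
  show "AE z in \<mu>. same_cell ((hurwitz_map ^^ n) z) ((hurwitz_map ^^ n) z)"
  proof (induction n)
    case 0
    show ?case using \<open>AE z in \<mu>. same_cell z z\<close> by simp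
  next
    case (Suc n)
    have "AE z in distr \<mu> \<mu> hurwitz_map. same_cell ((hurwitz_map ^^ n) z) ((hurwitz_map ^^ n) z)"
      unfolding ergodic_measureD(3)[OF hm_ergodic] by (rule Suc)
    from AE_distrD[OF ergodic_measureD(2)[OF hm_ergodic] this] show ?case
      by (simp add: funpow_swap1)
  qed
qed

lemma hm_open_pos:
  assumes "open W" "W \<noteq> {}" "W \<subseteq> hurwitz_domain"
  shows "measure \<mu> W > 0"
proof -
  interpret prob_space \<mu> using ergodic_measureD(1)[OF hm_ergodic] .
  have "W \<notin> null_sets lborel"
    using open_not_negligible[OF assms(1,2)] assms(1)
    unfolding negligible_iff_null_sets by (simp add: null_sets_completion_iff)
  then have "W \<notin> null_sets \<mu>" using hm_null_iff assms by simp
  moreover have "W \<in> sets \<mu>" using hm_sets_iff assms by simp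
  ultimately have "measure \<mu> W \<noteq> 0" by (auto simp: null_sets_def emeasure_eq_measure)
  then show ?thesis using measure_nonneg[of \<mu> W] by linarith
qed

text \<open>Positivity supplies infinitely many digits 3 in a typical expansion; the bound below 1
  makes long runs of 3 visible in the frequency. The latter holds because a first digit 3 forces
  positive real part, which excludes the left half of the square.\<close>

lemma hm_cylinder_3: "0 < measure \<mu> (hurwitz_cylinder [3])" "measure \<mu> (hurwitz_cylinder [3]) < 1"
proof -
  interpret prob_space \<mu> using ergodic_measureD(1)[OF hm_ergodic] .
  have "0 < measure \<mu> (interior (hurwitz_cylinder [3]))"
    using interior_cylinder_3 interior_subset[of "hurwitz_cylinder [3]"]
    by (intro hm_open_pos) (auto simp: hurwitz_cylinder_def)
  also have "\<dots> \<le> measure \<mu> (hurwitz_cylinder [3])"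
    by (intro finite_measure_mono interior_subset hm_cylinder_sets)
  finally show "0 < measure \<mu> (hurwitz_cylinder [3])" .
  define W where "W = open_square \<inter> {z. Re z < 0}"
  have "open W" unfolding W_def
    by (intro open_Int open_open_square open_Collect_less continuous_intros)
  moreover have "- 1/4 \<in> W" by (simp add: W_def open_square_def)
  moreover have Wd: "W \<subseteq> hurwitz_domain" using open_square_subset by (auto simp: W_def)
  ultimately have W: "0 < measure \<mu> W" "W \<in> sets \<mu>" using hm_open_pos[of W] hm_sets_iff by auto
  have "hurwitz_cylinder [3] \<subseteq> space \<mu> - W"
    using nearest_gauss_inverse_3 unfolding hm_space
    by (auto simp: hurwitz_cylinder_def hurwitz_quotient_def W_def dest: order.asym)
  then have "measure \<mu> (hurwitz_cylinder [3]) \<le> measure \<mu> (space \<mu> - W)"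
    using W by (intro finite_measure_mono) auto
  also have "\<dots> < 1" using W prob_compl by simp
  finally show "measure \<mu> (hurwitz_cylinder [3]) < 1" .
qed

text \<open>Regular words are countably many, so almost every point has the right frequency for all
  of them at once and also an orbit avoiding the walls; a probability space contains such a
  point.\<close>

lemma hm_exists_typical_orbit:
  obtains t a where "cell_orbit t a"
    and "\<And>b. regular_word b \<Longrightarrow> (\<lambda>N. real (word_count a b N) / real N) \<longlonglongrightarrow> measure \<mu> (hurwitz_cylinder b)"
proof -
  interpret prob_space \<mu> using ergodic_measureD(1)[OF hm_ergodic] .
  have "countable {b. regular_word b}"
    by (rule countable_subset[OF _ countable_lists[OF countable_gauss_int]]) (auto simp: regular_word_def)
  then have "AE z in \<mu>. \<forall>b\<in>{b. regular_word b}.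
      (\<lambda>N. (\<Sum>i<N. indicator (hurwitz_cylinder b) ((hurwitz_map ^^ i) z)) / real N) \<longlonglongrightarrow> measure \<mu> (hurwitz_cylinder b)"
    by (subst AE_ball_countable) (auto intro!: ergodic_average_indicator[OF hm_ergodic] hm_cylinder_sets)
  with hm_AE_orbit_same_cell
  have typical: "AE z in \<mu>. (\<forall>n. same_cell ((hurwitz_map ^^ n) z) ((hurwitz_map ^^ n) z)) \<and> (\<forall>b\<in>{b. regular_word b}.
      (\<lambda>N. (\<Sum>i<N. indicator (hurwitz_cylinder b) ((hurwitz_map ^^ i) z)) / real N) \<longlonglongrightarrow> measure \<mu> (hurwitz_cylinder b))"
    by (rule AE_conjI)
  have "ae_filter \<mu> \<noteq> bot" by (simp add: ae_filter_eq_bot_iff emeasure_space_1)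
  from eventually_happens'[OF this AE_conjI[OF AE_space typical]] obtain z where z: "z \<in> hurwitz_domain" "\<And>n. same_cell ((hurwitz_map ^^ n) z) ((hurwitz_map ^^ n) z)"
    and conv: "\<And>b. regular_word b \<Longrightarrow>
      (\<lambda>N. (\<Sum>i<N. indicator (hurwitz_cylinder b) ((hurwitz_map ^^ i) z)) / real N) \<longlonglongrightarrow> measure \<mu> (hurwitz_cylinder b)"
    unfolding hm_space by auto
  define t where "t = (\<lambda>n. (hurwitz_map ^^ n) z)"
  define a where "a = (\<lambda>n. nearest_gauss (inverse (t n)))"
  \<comment> \<open>Since 0 is on the unit circle around 1, an orbit avoiding the walls never
    reaches 0.\<close>
  have "(1::complex) \<in> gauss_int" by (simp add: gauss_int_def)
  then have "\<not> same_cell 0 0" unfolding same_cell_def by fastforce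
  then have nz: "t n \<noteq> 0" for n using z(2)[of n] unfolding t_def by metis
  have "cell_orbit t a"
  proof
    fix n
    show "a n \<in> gauss_int" unfolding a_def by (rule nearest_gauss_gauss_int)
    show "same_cell (t n) (t n)" unfolding t_def by (rule z(2))
    have "t (Suc n) = inverse (t n) - a n" using nz[of n] by (simp add: t_def a_def hurwitz_map_def)
    then show "t n * (a n + t (Suc n)) = 1" using nz[of n] by simp
  qed
  moreover have "(\<lambda>N. real (word_count a b N) / real N) \<longlonglongrightarrow> measure \<mu> (hurwitz_cylinder b)" if "regular_word b" for b
    using conv[OF that] sum_indicator_cylinder_eq_word_count[OF z(1), of a] nz unfolding t_def a_def by simp
  ultimately show ?thesis using that by blast
qed

end

section \<open>Sequences tending to infinity\<close>

lemma nat_between_consecutive: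
  fixes l :: "nat \<Rightarrow> nat"
  assumes l: "strict_mono l" and "l K \<le> N"
  obtains k where "k \<ge> K" "l k \<le> N" "N < l (Suc k)"
proof -
  define k where "k = (LEAST k. N < l (Suc k))"
  have "N < l (Suc N)" using strict_mono_imp_increasing[OF l, of "Suc N"] by simp
  then have k: "N < l (Suc k)" unfolding k_def by (rule LeastI)
  have "K < Suc k" using assms(2) k strict_mono_less[OF l] by (meson le_less_trans)
  moreover have "l k \<le> N"
  proof (cases "k = K")
    case False
    then obtain j where j: "k = Suc j" using \<open>K < Suc k\<close> by (cases k) auto
    then have "\<not> N < l (Suc j)" using not_less_Least[of j "\<lambda>k. N < l (Suc k)"] unfolding k_def by simp
    then show ?thesis using j by simp
  qed (use assms(2) in simp)
  ultimately show ?thesis using k that[of k] by simp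
qed

lemma sequence_limit_of_prefixes:
  fixes y :: "nat \<Rightarrow> nat \<Rightarrow> 'a" and l :: "nat \<Rightarrow> nat"
  assumes l: "strict_mono l" and y: "\<And>j i. i < l j \<Longrightarrow> y (Suc j) i = y j i"
  obtains w where "\<And>j i. i < l j \<Longrightarrow> w i = y j i"
proof -
  have le: "y k i = y j i" if "j \<le> k" "i < l j" for i j k
    using that
  proof (induction rule: dec_induct)
    case (step k)
    have "l j \<le> l k" using strict_mono_less_eq[OF l] step(1) by simp
    then show ?case using y[of i k] step by simp
  qed simp
  \<comment> \<open>Strict monotonicity gives \<open>i < l (Suc i)\<close>, so entry
    \<open>i\<close> is settled at stage \<open>Suc i\<close> and the limit can be read off
    there.\<close>
  have "y (Suc i) i = y j i" if "i < l j" for i j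
  proof (cases "j \<le> Suc i")
    case True
    then show ?thesis using le that by simp
  next
    case False
    moreover have "i < l (Suc i)" using strict_mono_imp_increasing[OF l, of "Suc i"] by simp
    ultimately show ?thesis using le[of "Suc i" j i] by simp
  qed
  then show ?thesis using that[of "\<lambda>i. y (Suc i) i"] by blast
qed

text \<open>Inside the closed set of all extensions of a given prefix by entries \<open>\<ge> n\<close>, the sequences tending
  to infinity are meagre, so a \<open>G\<^sub>\<delta>\<close> set of them misses all such extensions of some longer prefix.
  Iterating this for \<open>n = 0, 1, 2, \<dots>\<close> produces a sequence which tends to infinity and avoids every \<open>G n\<close>.\<close>

lemma not_Union_gdelta_of_reduction:
  fixes f :: "(nat \<Rightarrow> nat) \<Rightarrow> 'a :: topological_space"
  assumes cont: "\<And>x S. open S \<Longrightarrow> f x \<in> S \<Longrightarrow> \<exists>k. \<forall>y. (\<forall>i<k. y i = x i) \<longrightarrow> f y \<in> S"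
    and A: "\<And>x. f x \<in> A \<longleftrightarrow> (\<forall>m. \<exists>k. \<forall>i\<ge>k. m \<le> x i)"
    and G: "\<And>n::nat. gdelta (G n)"
  shows "A \<noteq> (\<Union>n. G n)"
proof
  assume AG: "A = (\<Union>n. G n)"
  have "\<exists>F. (\<forall>i::nat. open (F i)) \<and> G n = (\<Inter>i. F i)" for n
    using G[of n] by (auto simp: gdelta.simps)
  then obtain F where F: "\<And>n i::nat. open (F n i)" "\<And>n. G n = (\<Inter>i. F n i)" by metis
  \<comment> \<open>The Baire step. A pair of a sequence and a length stands for a finite prefix;
    entries beyond the length are irrelevant.\<close>
  have key: "\<exists>y l'. l < l' \<and> (\<forall>i<l. y i = x i) \<and> (\<forall>i. l \<le> i \<longrightarrow> i < l' \<longrightarrow> n \<le> y i) \<and>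
      (\<forall>z. (\<forall>i<l'. z i = y i) \<longrightarrow> (\<forall>i\<ge>l'. n \<le> z i) \<longrightarrow> f z \<notin> G n)" for n l :: nat and x :: "nat \<Rightarrow> nat"
  proof (rule ccontr)
    assume contr: "\<not> ?thesis"
    have H: "\<exists>z. (\<forall>i<l'. z i = y i) \<and> (\<forall>i\<ge>l'. n \<le> z i) \<and> f z \<in> G n"
      if "l < l'" "\<forall>i<l. y i = x i" "\<forall>i. l \<le> i \<longrightarrow> i < l' \<longrightarrow> n \<le> y i" for y l'
      using contr that by blast
    define P where "P = (\<lambda>(y::nat \<Rightarrow> nat, l'). l < l' \<and> (\<forall>i<l. y i = x i) \<and> (\<forall>i. l \<le> i \<longrightarrow> i < l' \<longrightarrow> n \<le> y i))"
    \<comment> \<open>Stage \<open>j\<close> forces the image into \<open>F n j\<close> and inserts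
      one more entry equal to \<open>n\<close>. The limit would be mapped into \<open>G n\<close>
      although it takes the value \<open>n\<close> infinitely often.\<close>
    define Q where "Q = (\<lambda>j (y::nat \<Rightarrow> nat, k) (y'::nat \<Rightarrow> nat, k'). k < k' \<and> (\<forall>i<k. y' i = y i) \<and>
      (\<exists>i\<ge>k. i < k' \<and> y' i = n) \<and> (\<forall>z. (\<forall>i<k'. z i = y' i) \<longrightarrow> f z \<in> F n j))"
    have "\<exists>s. \<forall>j. P (s j) \<and> Q j (s j) (s (Suc j))"
    proof (rule dependent_nat_choice)
      have "P (x(l := n), Suc l)" by (auto simp: P_def)
      then show "\<exists>s. P s" ..
    next
      fix s j assume Ps: "P s"
      obtain y k where s: "s = (y, k)" by (cases s)
      obtain z where z: "\<forall>i<k. z i = y i" "\<forall>i\<ge>k. n \<le> z i" "f z \<in> G n"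
        using H[of k y] Ps unfolding P_def s by auto
      have "f z \<in> F n j" using z(3) F(2) by blast
      then obtain m where m: "\<And>w. \<forall>i<m. w i = z i \<Longrightarrow> f w \<in> F n j" using cont[OF F(1)] by blast
      define k' where "k' = max m k"
      \<comment> \<open>The entry \<open>n\<close> is placed at or beyond the modulus of continuity
        \<open>m\<close>, so the new prefix still forces the image into
        \<open>F n j\<close>.\<close>
      define y' where "y' = z(k' := n)"
      have k': "m \<le> k'" "k \<le> k'" by (auto simp: k'_def)
      have "f w \<in> F n j" if "\<forall>i<Suc k'. w i = y' i" for w
        using that k' by (intro m) (auto simp: y'_def)
      moreover have "\<forall>i<k. y' i = y i" using z(1) k' by (auto simp: y'_def)
      moreover have "y' k' = n" by (simp add: y'_def)
      ultimately have "Q j s (y', Suc k')" unfolding Q_def s using k' by auto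
      moreover have "P (y', Suc k')"
        using Ps z k' unfolding P_def s by (auto simp: y'_def) (metis not_le)
      ultimately show "\<exists>s'. P s' \<and> Q j s s'" by blast
    qed
    then obtain s where s: "\<And>j. P (s j)" "\<And>j. Q j (s j) (s (Suc j))" by blast
    define y where "y = (\<lambda>j. fst (s j))"
    define k where "k = (\<lambda>j. snd (s j))"
    have sj: "s j = (y j, k j)" for j by (simp add: y_def k_def)
    have step: "k j < k (Suc j)" "\<And>i. i < k j \<Longrightarrow> y (Suc j) i = y j i"
      "\<exists>i\<ge>k j. i < k (Suc j) \<and> y (Suc j) i = n" "\<And>z. \<forall>i<k (Suc j). z i = y (Suc j) i \<Longrightarrow> f z \<in> F n j" for j
      using s(2)[of j] unfolding sj Q_def by auto
    have mono: "strict_mono k" using step(1) by (rule strict_monoI_Suc)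
    obtain w where w: "\<And>j i. i < k j \<Longrightarrow> w i = y j i"
      using sequence_limit_of_prefixes[OF mono, of y] step(2) by blast
    have "f w \<in> F n j" for j using w step(4)[of j] by blast
    then have "f w \<in> A" unfolding AG F(2) by blast
    then obtain j where j: "\<forall>i\<ge>j. Suc n \<le> w i" using A by blast
    obtain i where i: "i \<ge> k j" "i < k (Suc j)" "y (Suc j) i = n" using step(3) by blast
    have "j \<le> i" using i(1) strict_mono_imp_increasing[OF mono, of j] by simp
    then show False using j i w[of i "Suc j"] by auto
  qed
  \<comment> \<open>Now \<open>key\<close> is iterated with the stage number as lower bound: stage
    \<open>n\<close> excludes \<open>G n\<close> for all continuations with entries at least
    \<open>n\<close>, and later stages provide such a continuation.\<close>
  define Q where "Q = (\<lambda>n (y::nat \<Rightarrow> nat, k) (y'::nat \<Rightarrow> nat, k'). k < k' \<and> (\<forall>i<k. y' i = y i) \<and>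
      (\<forall>i. k \<le> i \<longrightarrow> i < k' \<longrightarrow> n \<le> y' i) \<and> (\<forall>z. (\<forall>i<k'. z i = y' i) \<longrightarrow> (\<forall>i\<ge>k'. n \<le> z i) \<longrightarrow> f z \<notin> G n))"
  have "\<exists>s. \<forall>n. True \<and> Q n (s n) (s (Suc n))"
  proof (rule dependent_nat_choice)
    fix s :: "(nat \<Rightarrow> nat) \<times> nat" and n
    obtain y k where s: "s = (y, k)" by (cases s)
    show "\<exists>s'. True \<and> Q n s s'" using key[of k y n] unfolding s Q_def by auto
  qed simp
  then obtain s where s: "\<And>n. Q n (s n) (s (Suc n))" by blast
  define y where "y = (\<lambda>j. fst (s j))"
  define k where "k = (\<lambda>j. snd (s j))"
  have sj: "s j = (y j, k j)" for j by (simp add: y_def k_def)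
  have step: "k j < k (Suc j)" "\<And>i. i < k j \<Longrightarrow> y (Suc j) i = y j i"
    "\<And>i. k j \<le> i \<Longrightarrow> i < k (Suc j) \<Longrightarrow> j \<le> y (Suc j) i"
    "\<And>z. \<forall>i<k (Suc j). z i = y (Suc j) i \<Longrightarrow> \<forall>i\<ge>k (Suc j). j \<le> z i \<Longrightarrow> f z \<notin> G j" for j
    using s[of j] unfolding sj Q_def by auto
  have mono: "strict_mono k" using step(1) by (rule strict_monoI_Suc)
  obtain w where w: "\<And>j i. i < k j \<Longrightarrow> w i = y j i"
    using sequence_limit_of_prefixes[OF mono, of y] step(2) by blast
  have large: "n \<le> w i" if ni: "k n \<le> i" for n i
  proof -
    obtain m where m: "m \<ge> n" "k m \<le> i" "i < k (Suc m)" using nat_between_consecutive[OF mono ni] .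
    then show ?thesis using step(3)[of m i] w[of i "Suc m"] by simp
  qed
  then have "f w \<in> A" using A by blast
  then obtain n where n: "f w \<in> G n" using AG by blast
  have "f w \<notin> G n"
  proof (rule step(4))
    show "\<forall>i\<ge>k (Suc n). n \<le> w i" using large[of "Suc n"] by (metis Suc_leD)
  qed (use w in simp)
  then show False using n by blast
qed

text \<open>In a metric space a closed set is the intersection of its open neighbourhoods of radius
  \<open>1 / (n + 1)\<close>.\<close>

lemma closed_imp_gdelta:
  fixes S :: "'a :: metric_space set"
  assumes "closed S"
  shows "gdelta S"
proof -
  define F where "F = (\<lambda>n::nat. \<Union>y\<in>S. ball y (1 / real (Suc n)))"
  have "(\<Inter>n. F n) \<subseteq> closure S"
  proof
    fix z assume z: "z \<in> (\<Inter>n. F n)"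
    have "\<exists>y\<in>S. dist y z < e" if e: "e > 0" for e
    proof -
      obtain n where n: "1 / real (Suc n) < e" using nat_approx_posE[OF e] by blast
      obtain y where "y \<in> S" "dist y z < 1 / real (Suc n)" using z by (force simp: F_def)
      then show ?thesis using n less_trans by blast
    qed
    then show "z \<in> closure S" by (simp add: closure_approachable)
  qed
  moreover have "S \<subseteq> F n" for n
    unfolding F_def by (rule subsetI, rule UN_I, assumption) simp
  ultimately have "S = (\<Inter>n. F n)" using closure_closed[OF assms] by blast
  moreover have "open (F n)" for n unfolding F_def by blast
  ultimately show ?thesis using gdelta.intros[of F] by simp
qed

section \<open>The reduction\<close>

text \<open>The growth condition puts each run before the next position, and all runs up to the
  \<open>k\<close>-th below \<open>2 * p k + 2\<close>, at most the fraction
  \<open>1 / (k + 2)\<close> of \<open>p (Suc k)\<close>.\<close>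

locale sparse_cell_orbit = cell_orbit +
  fixes p :: "nat \<Rightarrow> nat"
  assumes p_digit: "\<And>k. a (p k) = 3"
    and p_growth: "\<And>k. p (Suc k) \<ge> (k + 2) * (2 * p k + 2)"
begin

text \<open>The length of the \<open>k\<close>-th run is comparable to \<open>p k\<close> while
  \<open>x k\<close> stays bounded and negligible against it when \<open>x k\<close> grows. The
  summand 1 keeps every run nonempty, so that infinitely many digits are 3.\<close>

definition blocks :: "(nat \<Rightarrow> nat) \<Rightarrow> nat set" where
  "blocks x = (\<Union>k. {p k<..p k + 1 + p k div (x k + 1)})"

lemma block_end: "p k + 1 + p k div (m + 1) < p (Suc k)"
proof -
  have "2 * (2 * p k + 2) \<le> (k + 2) * (2 * p k + 2)" by (intro mult_right_mono) auto
  then have "2 * (2 * p k + 2) \<le> p (Suc k)" using p_growth[of k] by (rule order_trans)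
  moreover have "p k div (m + 1) \<le> p k" by (rule div_le_dividend)
  ultimately show ?thesis by (simp del: div_le_dividend)
qed

lemma p_mono: "strict_mono p"
proof (rule strict_monoI_Suc)
  show "p k < p (Suc k)" for k using block_end[of k 0] by simp
qed

lemma p_ge: "k \<le> p k"
  using strict_mono_imp_increasing[OF p_mono] .

lemma blocks_between:
  assumes "p k \<le> n" "n \<le> p (Suc k)"
  shows "n \<in> blocks x \<longleftrightarrow> p k < n \<and> n \<le> p k + 1 + p k div (x k + 1)"
proof -
  have "j = k" if "p j < n" "n \<le> p j + 1 + p j div (x j + 1)" for j
  proof -
    have "p j < p (Suc k)" using that(1) assms(2) by simp
    then have "j \<le> k" using strict_mono_less[OF p_mono] by simp
    have "p k < p (Suc j)" using that(2) assms(1) block_end[of j "x j"] by simp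
    then have "k \<le> j" using strict_mono_less[OF p_mono] by simp
    with \<open>j \<le> k\<close> show ?thesis by simp
  qed
  then show ?thesis unfolding blocks_def by auto
qed

lemma blocks_spliceable: "spliceable (blocks x)"
  unfolding spliceable_def
proof (intro allI impI)
  fix n assume n: "n \<notin> blocks x" "Suc n \<in> blocks x"
  then obtain k where k: "p k < Suc n" "Suc n \<le> p k + 1 + p k div (x k + 1)" unfolding blocks_def by auto
  have "\<not> p k < n" using n(1) k(2) unfolding blocks_def by force
  then have "n = p k" using k(1) by simp
  then show "a n = 3" using p_digit by simp
qed

lemma blocks_unbounded: "\<exists>n\<ge>m. n \<in> blocks x"
proof (intro exI conjI)
  show "Suc (p m) \<ge> m" using p_ge[of m] by simp
  show "Suc (p m) \<in> blocks x" unfolding blocks_def by force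
qed

text \<open>As \<open>k \<le> p k\<close>, runs with index at least \<open>k\<close> begin beyond
  \<open>k\<close>. This is the source of continuity in \<open>x\<close>.\<close>

lemma blocks_cong:
  assumes "\<And>i. i < k \<Longrightarrow> x i = y i" "n < k"
  shows "n \<in> blocks x \<longleftrightarrow> n \<in> blocks y"
proof -
  have "n \<in> {p j<..p j + 1 + p j div (x j + 1)} \<longleftrightarrow> n \<in> {p j<..p j + 1 + p j div (y j + 1)}" for j
  proof (cases "j < k")
    case False
    then show ?thesis using p_ge[of j] assms(2) by simp
  qed (use assms(1) in simp)
  then show ?thesis unfolding blocks_def by blast
qed

text \<open>The first fraction bounds all runs up to the \<open>k\<close>-th by the growth
  condition, the second bounds the current run \<open>Suc k\<close>, and 1 is its extra
  element.\<close>

lemma card_blocks: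
  assumes "p (Suc k) < N" "N \<le> p (Suc (Suc k))"
  shows "real (card (blocks x \<inter> {..<N})) \<le> real N * (1 / real (k + 2) + 1 / real (x (Suc k) + 1)) + 1"
proof -
  let ?q = "p (Suc k)"
  have "blocks x \<inter> {..<N} \<subseteq> {..<2 * p k + 2} \<union> {?q<..?q + 1 + ?q div (x (Suc k) + 1)}"
  proof
    fix n assume n: "n \<in> blocks x \<inter> {..<N}"
    show "n \<in> {..<2 * p k + 2} \<union> {?q<..?q + 1 + ?q div (x (Suc k) + 1)}"
    proof (cases "?q \<le> n")
      case True
      then show ?thesis using n assms(2) blocks_between[of "Suc k" n x] by auto
    next
      case False
      show ?thesis
      proof (cases "p k \<le> n")
        case True
        then have "n \<le> p k + 1 + p k div (x k + 1)" using False n blocks_between[of k n x] by auto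
        also have "\<dots> \<le> p k + 1 + p k" by simp
        finally show ?thesis by simp
      qed simp
    qed
  qed
  then have "card (blocks x \<inter> {..<N}) \<le> card ({..<2 * p k + 2} \<union> {?q<..?q + 1 + ?q div (x (Suc k) + 1)})"
    by (intro card_mono) auto
  also have "\<dots> \<le> (2 * p k + 2) + (1 + ?q div (x (Suc k) + 1))"
    by (rule order_trans[OF card_Un_le]) simp
  finally have 1: "real (card (blocks x \<inter> {..<N})) \<le> real (2 * p k + 2) + 1 + real (?q div (x (Suc k) + 1))"
    by linarith
  have "real (2 * p k + 2) * real (k + 2) \<le> real ?q"
    using p_growth[of k] by (metis mult.commute of_nat_le_iff of_nat_mult)
  then have 2: "real (2 * p k + 2) \<le> real N * (1 / real (k + 2))"
    using assms(1) by (simp add: field_simps del: of_nat_add of_nat_mult of_nat_Suc)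
  have "real (?q div (x (Suc k) + 1)) \<le> real ?q / real (x (Suc k) + 1)" by (rule of_nat_div_le_of_nat)
  also have "\<dots> \<le> real N * (1 / real (x (Suc k) + 1))"
    using assms(1) by (simp add: divide_right_mono)
  finally show ?thesis using 1 2 by (simp add: distrib_left)
qed

lemma blocks_density_zero:
  assumes x: "\<forall>m. \<exists>k. \<forall>i\<ge>k. m \<le> x i"
  shows "(\<lambda>N. real (card (blocks x \<inter> {..<N})) / real N) \<longlonglongrightarrow> 0"
proof (rule LIMSEQ_I)
  fix e :: real assume "e > 0"
  then obtain m where m: "1 / real (Suc m) < e / 3" using nat_approx_posE[of "e/3"] by auto
  obtain K where K: "\<And>i. i \<ge> K \<Longrightarrow> m \<le> x i" using x by blast
  have small: "1 / real (j + 1) < e / 3" if "j \<ge> m" for j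
    using m that frac_le[of 1 1 "real (Suc m)" "real (j + 1)"] by simp
  show "\<exists>no. \<forall>N\<ge>no. norm (real (card (blocks x \<inter> {..<N})) / real N - 0) < e"
  proof (intro exI allI impI)
    fix N assume N: "N \<ge> Suc (p (Suc (K + m)))"
    \<comment> \<open>Working with \<open>N - 1\<close> yields
      \<open>p k < N \<le> p (Suc k)\<close>, the form required by \<open>card_blocks\<close>. The
      three thirds of \<open>e\<close> go to earlier runs, the current run and the extra
      element.\<close>
    then have "p (Suc (K + m)) \<le> N - 1" by simp
    then obtain k where k: "k \<ge> Suc (K + m)" "p k \<le> N - 1" "N - 1 < p (Suc k)"
      using nat_between_consecutive[OF p_mono] by blast
    then obtain j where j: "k = Suc j" "j \<ge> K + m" by (cases k) auto
    have "real (card (blocks x \<inter> {..<N})) \<le> real N * (1 / real (j + 2) + 1 / real (x (Suc j) + 1)) + 1"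
      using card_blocks[of j N x] k N unfolding j by simp
    also have "1 / real (j + 2) + 1 / real (x (Suc j) + 1) < e / 3 + e / 3"
      using small[of "j + 1"] small[of "x (Suc j)"] K[of "Suc j"] j by simp
    then have "real N * (1 / real (j + 2) + 1 / real (x (Suc j) + 1)) + 1 \<le> real N * (e / 3 + e / 3) + 1"
      by (intro add_right_mono mult_left_mono) auto
    also have "1 < real N * (e / 3)"
    proof -
      have "m \<le> N - 1" using p_ge[of "Suc (K + m)"] N by simp
      then have "1 / real N < e / 3" using small[of "N - 1"] N by simp
      then show ?thesis using N by (simp add: field_simps)
    qed
    finally have "real (card (blocks x \<inter> {..<N})) < real N * e" by (simp add: algebra_simps)
    then show "norm (real (card (blocks x \<inter> {..<N})) / real N - 0) < e"
      using N by (simp add: field_simps)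
  qed
qed

text \<open>The overwritten positions have density zero, so by \<open>word_count_diff\<close> no
  word frequency changes in the limit.\<close>

lemma splice_word_count_tendsto:
  assumes x: "\<forall>m. \<exists>k. \<forall>i\<ge>k. m \<le> x i"
    and conv: "(\<lambda>N. real (word_count a b N) / real N) \<longlonglongrightarrow> c"
  shows "(\<lambda>N. real (word_count (splice (blocks x)) b N) / real N) \<longlonglongrightarrow> c"
proof -
  let ?d = "splice (blocks x)"
  let ?err = "\<lambda>N. real (length b) * (real (card (blocks x \<inter> {..<N})) / real N + real (length b) / real N)"
  have err: "?err \<longlonglongrightarrow> real (length b) * (0 + 0)"
    by (intro tendsto_intros blocks_density_zero[OF x] lim_const_over_n)
  have "\<bar>real (word_count ?d b N) / real N - real (word_count a b N) / real N\<bar> \<le> ?err N" for N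
  proof -
    have "\<bar>real (word_count ?d b N) - real (word_count a b N)\<bar>
        \<le> real (length b) * (real (card (blocks x \<inter> {..<N})) + real (length b))"
      by (rule word_count_diff) (simp add: splice_def)
    then have "\<bar>real (word_count ?d b N) - real (word_count a b N)\<bar> / real N
        \<le> real (length b) * (real (card (blocks x \<inter> {..<N})) + real (length b)) / real N"
      by (rule divide_right_mono) simp
    moreover have "\<bar>real (word_count ?d b N) / real N - real (word_count a b N) / real N\<bar>
        = \<bar>real (word_count ?d b N) - real (word_count a b N)\<bar> / real N"
      by (simp flip: diff_divide_distrib)
    ultimately show ?thesis by (simp only: times_divide_eq_right flip: add_divide_distrib)
  qed
  then have "\<forall>\<^sub>F N in sequentially. norm (real (word_count ?d b N) / real N - real (word_count a b N) / real N) \<le> ?err N"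
    by (simp only: real_norm_def eventually_True)
  from Lim_null_comparison[OF this] err
  have "(\<lambda>N. real (word_count ?d b N) / real N - real (word_count a b N) / real N) \<longlonglongrightarrow> 0"
    by (simp only: add_0_right mult_zero_right)
  from tendsto_add[OF this conv] show ?thesis by simp
qed

text \<open>A run of the digit 3 of length proportional to its position \<open>p k\<close> makes the frequency of 3 jump,
  unless that frequency is already 1.\<close>

lemma splice_word_count_not_tendsto:
  assumes x: "\<not> (\<forall>m. \<exists>k. \<forall>i\<ge>k. m \<le> x i)" and c: "c < 1"
  shows "\<not> (\<lambda>N. real (word_count (splice (blocks x)) [3] N) / real N) \<longlonglongrightarrow> c"
proof
  let ?w = "\<lambda>N. real (word_count (splice (blocks x)) [3] N)"
  assume conv: "(\<lambda>N. ?w N / real N) \<longlonglongrightarrow> c"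
  obtain m where m: "\<And>k. \<exists>i\<ge>k. x i < m" using x by (meson not_le)
  \<comment> \<open>The run raises the centred count by \<open>(1 - c) * L\<close>, while deviations
    of at most \<open>e\<close> at both ends allow only \<open>3 * e * P\<close>. With
    \<open>P \<le> L * Suc m\<close>, the factor 8 bounds this by 3/8 of the required
    amount.\<close>
  define e where "e = (1 - c) / (8 * real (Suc m))"
  have "e > 0" using c by (simp add: e_def)
  then obtain n0 where n0: "\<And>N. N \<ge> n0 \<Longrightarrow> \<bar>?w N / real N - c\<bar> < e"
    using LIMSEQ_D[OF conv \<open>e > 0\<close>] by auto
  have dev: "\<bar>?w N - c * real N\<bar> \<le> e * real N" if "N \<ge> n0" "N > 0" for N
  proof -
    have "?w N - c * real N = (?w N / real N - c) * real N" using that(2) by (simp add: field_simps)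
    then have "\<bar>?w N - c * real N\<bar> = \<bar>?w N / real N - c\<bar> * real N" by (simp add: abs_mult)
    also have "\<dots> \<le> e * real N" using n0[OF that(1)] by (intro mult_right_mono) auto
    finally show ?thesis .
  qed
  obtain k where k: "k \<ge> n0" "x k < m" using m by blast
  define P where "P = p k + 1"
  define L where "L = 1 + p k div (x k + 1)"
  have P: "P \<ge> n0" "P > 0" using k(1) p_ge[of k] by (auto simp: P_def)
  have LP: "L \<le> P" unfolding L_def P_def by simp
  have "{j. j < P + L \<and> splice (blocks x) j = 3} = {j. j < P \<and> splice (blocks x) j = 3} \<union> {P..<P + L}"
  proof -
    have "splice (blocks x) j = 3" if "j \<in> {P..<P + L}" for j
    proof -
      have "j \<in> blocks x" unfolding blocks_def using that by (intro UN_I[of k]) (auto simp: P_def L_def)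
      then show ?thesis by (simp add: splice_def)
    qed
    then show ?thesis by auto
  qed
  moreover have "card ({j. j < P \<and> splice (blocks x) j = 3} \<union> {P..<P + L})
      = card {j. j < P \<and> splice (blocks x) j = 3} + L"
    by (subst card_Un_disjoint) auto
  ultimately have jump: "?w (P + L) = ?w P + real L" by (simp add: word_count_def)
  have "(1 - c) * real L = (?w (P + L) - c * real (P + L)) - (?w P - c * real P)"
    unfolding jump by (simp add: algebra_simps)
  also have "\<dots> \<le> e * real (P + L) + e * real P" using dev[of P] dev[of "P + L"] P by simp
  also have "\<dots> \<le> 3 * e * real P" using LP \<open>e > 0\<close> by (simp add: algebra_simps)
  finally have 1: "(1 - c) * real L \<le> 3 * e * real P" .
  \<comment> \<open>Because \<open>x k < m\<close>, the run has at least the fraction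
    \<open>1 / Suc m\<close> of \<open>P\<close>; the summand 1 in \<open>L\<close> absorbs the
    rounding of \<open>div\<close>.\<close>
  have "P \<le> L * Suc m"
  proof -
    have "p k < (x k + 1) * L"
      unfolding L_def using dividend_less_times_div[of "x k + 1" "p k"] by simp
    also have "\<dots> \<le> Suc m * L" using k(2) by (intro mult_right_mono) auto
    finally show ?thesis by (simp add: P_def mult.commute)
  qed
  then have "real P \<le> real L * real (Suc m)" by (metis of_nat_le_iff of_nat_mult)
  then have "3 * e * real P \<le> 3 * e * (real L * real (Suc m))" using \<open>e > 0\<close> by (intro mult_left_mono) auto
  also have "\<dots> = 3/8 * ((1 - c) * real L)"
  proof -
    have "e * real (Suc m) = (1 - c) / 8" unfolding e_def by (simp del: of_nat_Suc)
    then show ?thesis by (simp add: mult.assoc mult.left_commute[of e])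
  qed
  finally have "(1 - c) * real L \<le> 3/8 * ((1 - c) * real L)" using 1 by linarith
  moreover have "(1 - c) * real L > 0" using c by (simp add: L_def)
  ultimately show False by linarith
qed

lemma spliced_continuous:
  assumes S: "open S" "spliced (blocks x) 0 \<in> S"
  shows "\<exists>k. \<forall>y. (\<forall>i<k. y i = x i) \<longrightarrow> spliced (blocks y) 0 \<in> S"
proof -
  obtain e where e: "e > 0" "ball (spliced (blocks x) 0) e \<subseteq> S" using S openE by blast
  obtain k where k: "(1/2) ^ k < e / 4" using real_arch_pow_inv[of "e/4" "1/2"] e(1) by auto
  have "spliced (blocks y) 0 \<in> S" if "\<forall>i<k. y i = x i" for y
  proof -
    have "norm (spliced (blocks x) 0 - spliced (blocks y) 0) \<le> 4 * (1/2) ^ k"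
      using that by (intro spliced_dist_spliced blocks_spliceable blocks_cong) auto
    then have "spliced (blocks y) 0 \<in> ball (spliced (blocks x) 0) e" using k by (simp add: dist_norm)
    then show ?thesis using e(2) by blast
  qed
  then show ?thesis by blast
qed

text \<open>The spliced digits are the Hurwitz digits of the point. If \<open>x\<close> tends to
  infinity, all frequencies survive; otherwise the regular word \<open>[3]\<close> already has no
  correct frequency.\<close>

lemma spliced_hurwitz_normal_iff:
  assumes conv: "\<And>b. regular_word b \<Longrightarrow>
      (\<lambda>N. real (word_count a b N) / real N) \<longlonglongrightarrow> measure \<mu> (hurwitz_cylinder b)"
    and less: "measure \<mu> (hurwitz_cylinder [3]) < 1"
  shows "spliced (blocks x) 0 \<in> hurwitz_normal \<mu> \<longleftrightarrow> (\<forall>m. \<exists>k. \<forall>i\<ge>k. m \<le> x i)"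
proof -
  let ?R = "blocks x"
  note v = spliced_step[OF blocks_spliceable[of x]] splice_int[of ?R]
    spliced_square[OF blocks_spliceable[of x] blocks_unbounded]
  note orbit = hurwitz_orbit_of_expansion[of "spliced ?R" "splice ?R", OF v]
  have "spliced ?R 0 \<in> hurwitz_domain" using v(3) open_square_subset by blast
  moreover have "spliced ?R 0 \<notin> gauss_rat" using not_gauss_rat_of_infinite_expansion[of "spliced ?R" "splice ?R", OF v] .
  ultimately have "spliced ?R 0 \<in> hurwitz_normal \<mu> \<longleftrightarrow> (\<forall>b. b \<noteq> [] \<longrightarrow> regular_word b \<longrightarrow>
    (\<lambda>N. real (word_count (splice ?R) b N) / real N) \<longlonglongrightarrow> measure \<mu> (hurwitz_cylinder b))"
    by (rule hurwitz_normal_iff_word_count) (simp add: orbit)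
  then show ?thesis
    using splice_word_count_tendsto[of x, OF _ conv] splice_word_count_not_tendsto[of x, OF _ less] regular_word_3
    by blast
qed

end

text \<open>A digit of positive frequency occurs infinitely often, so the positions can be chosen
  recursively as far out as the growth condition demands.\<close>

lemma (in cell_orbit) exists_sparse_positions:
  assumes conv: "(\<lambda>N. real (word_count a [3] N) / real N) \<longlonglongrightarrow> c" and c: "c > 0"
  obtains p where "sparse_cell_orbit t a p"
proof -
  have ex: "\<exists>n\<ge>m. a n = 3" for m
  proof (rule ccontr)
    assume "\<not> ?thesis"
    then have "{j. j < N \<and> a j = 3} \<subseteq> {..<m}" for N using not_le by auto
    then have bound: "word_count a [3] N \<le> m" for N
      unfolding word_count_def using card_mono[of "{..<m}" "{j. j < N \<and> a j = 3}"] by simp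
    have "(\<lambda>N. real (word_count a [3] N) / real N) \<longlonglongrightarrow> 0"
      by (rule Lim_null_comparison[OF _ lim_const_over_n[of "real m"]])
        (use bound in \<open>auto intro!: always_eventually divide_right_mono\<close>)
    then show False using LIMSEQ_unique[OF conv] c by auto
  qed
  have "\<exists>p. \<forall>k. a (p k) = 3 \<and> p (Suc k) \<ge> (k + 2) * (2 * p k + 2)"
  proof (rule dependent_nat_choice)
    show "\<exists>n. a n = 3" using ex by blast
    fix n k :: nat
    show "\<exists>n'. a n' = 3 \<and> n' \<ge> (k + 2) * (2 * n + 2)"
      using ex[of "(k + 2) * (2 * n + 2)"] by blast
  qed
  then obtain p where "sparse_cell_orbit t a p"
    unfolding sparse_cell_orbit_def sparse_cell_orbit_axioms_def using cell_orbit_axioms by blast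
  then show ?thesis using that by blast
qed

theorem theorem1p2:
  fixes \<mu> :: "complex measure"
  assumes "is_hurwitz_measure \<mu>"
  shows "\<not> gdelta (hurwitz_normal \<mu>)
    \<and> \<not> fsigma (hurwitz_normal \<mu>)
    \<and> \<not> (\<exists>G :: nat \<Rightarrow> complex set. (\<forall>n. gdelta (G n)) \<and> hurwitz_normal \<mu> = (\<Union>n. G n))"
proof -
  obtain t a where ta: "cell_orbit t a"
    and conv: "\<And>b. regular_word b \<Longrightarrow> (\<lambda>N. real (word_count a b N) / real N) \<longlonglongrightarrow> measure \<mu> (hurwitz_cylinder b)"
    using hm_exists_typical_orbit[OF assms] by blast
  obtain p where "sparse_cell_orbit t a p"
    using cell_orbit.exists_sparse_positions[OF ta conv[OF regular_word_3] hm_cylinder_3(1)[OF assms]] .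
  then interpret sparse_cell_orbit t a p .
  have main: "hurwitz_normal \<mu> \<noteq> (\<Union>n. G n)" if "\<And>n. gdelta (G n)" for G :: "nat \<Rightarrow> complex set"
    by (rule not_Union_gdelta_of_reduction[of "\<lambda>x. spliced (blocks x) 0", OF spliced_continuous
          spliced_hurwitz_normal_iff[OF conv hm_cylinder_3(2)[OF assms]] that])
  \<comment> \<open>Both remaining claims are special cases: a constant union, and a union of closed
    sets, each of which is a \<open>G\<^sub>\<delta>\<close> set.\<close>
  moreover have "\<not> gdelta (hurwitz_normal \<mu>)"
    using main[of "\<lambda>_. hurwitz_normal \<mu>"] by auto
  moreover have "\<not> fsigma (hurwitz_normal \<mu>)"
  proof
    assume "fsigma (hurwitz_normal \<mu>)"
    then obtain F :: "nat \<Rightarrow> complex set" where F: "\<And>n. closed (F n)" "hurwitz_normal \<mu> = (\<Union>n. F n)"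
      by (auto simp: fsigma.simps)
    have "gdelta (F n)" for n
      using F(1)[of n] closed_imp_gdelta by blast
    then show False using main[of F] F(2) by blast
  qed
  ultimately show ?thesis by blast
qed

end
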